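(* Let $\lambda\in\mathbb{C}^\times$ and $a,b\in\mathbb{C}$. For any $\alpha,\beta,z\in\mathbb{C}$, we have $B_zM_{\alpha,\beta}^{\lambda,a,b}\cong M_{\alpha-2z,\beta}^{\lambda,a,b}$ as $\mathfrak{g}$-modules, where $B_z$ denotes Mathieu's twisting functor.
   Context: All vector spaces and algebras are over $\mathbb{C}$; $\mathbb{C}^\times=\mathbb{C}\setminus\{0\}$, $\mathbb{N}=\{1,2,\dots\}$. $\mathfrak{g}=\mathfrak{sl}_2\otimes_{\mathbb{C}}\mathbb{C}[t]/(t^2)$ is the Takiff Lie algebra for $\mathfrak{sl}_2$, with $[x\otimes t^i,y\otimes t^j]=[x,y]\otimes t^{i+j}$. With the standard basis $e,h,f$ of $\mathfrak{sl}_2$ ($[e,f]=h$, $[h,e]=2e$, $[h,f]=-2f$), identify $x$ with $x\otimes 1$ and put $\overline{x}=x\otimes t$ for $x\in\{e,h,f\}$. Write $\overline{\partial}=\partial/\partial\overline{h}$. $\Gamma(\lambda,a,b)$ is the $\mathfrak{g}$-module with underlying space $\mathbb{C}[h,\overline{h}]$, with $h,\overline{h}$ acting by multiplication and, for $\gamma=\gamma(h,\overline{h})$, $e\cdot\gamma=-2\lambda\,\overline{\partial}(\gamma(h-2,\overline{h}))$, $\overline{e}\cdot\gamma=\lambda\gamma(h-2,\overline{h})$, $\overline{f}\cdot\gamma=-\frac{1}{4\lambda}(\overline{h}^2+a)\gamma(h+2,\overline{h})$, $f\cdot\gamma=-\frac{1}{2\lambda}((h+2)\overline{h}+b)\gamma(h+2,\overline{h})-\frac{1}{2\lambda}(\overline{h}^2+a)\overline{\partial}(\gamma(h+2,\overline{h}))$.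 For a $\mathfrak{g}$-module $M$, the dual space $M^*$ is a $\mathfrak{g}$-module via $(y\cdot\varphi)(v)=-\varphi(y\cdot v)$ for $y\in\mathfrak{g}$. Put $\alpha_k=\alpha+2k$. For $k\in\mathbb{Z}$, $s\in\mathbb{N}$, $\eta_{\alpha_k,\beta^s}:\mathbb{C}[h,\overline{h}]\to\mathbb{C}$ is the linear functional with $\eta_{\alpha_k,\beta^s}\big((h-\alpha_k)^i(\overline{h}-\beta)^j\big)=\delta_{i,0}\delta_{j,s-1}(s-1)!$ for all $i,j\ge0$ (the superscript in $\beta^s$ is only an index). $M_{\alpha,\beta}^{\lambda,a,b}$ is the submodule of $\Gamma(\lambda,a,b)^*$ with basis $\{\eta_{\alpha_k,\beta^s}: k\in\mathbb{Z},\,s\in\mathbb{N}\}$. Twisting functors: $U^{(\overline{e})}$ is the localization of $U(\mathfrak{g})$ with respect to the multiplicative set $\{\overline{e}^i: i\in\mathbb{N}\}$, i.e. the associative algebra generated by $\overline{e}^{-1},\overline{e},\overline{f},\overline{h},e,f,h$ subject to the defining relations of $U(\mathfrak{g})$ and $\overline{e}^{-1}\overline{e}=\overline{e}\,\overline{e}^{-1}=1$. For $z\in\mathbb{C}$, $\Theta_z$ is the unique automorphism of $U^{(\overline{e})}$ with $\Theta_z(f)=f-z\overline{e}^{-1}\overline{h}$, $\Theta_z(h)=h+2z$, and $\Theta_z(u)=u$ for $u\in\{\overline{f},\overline{h},\overline{e},e,\overline{e}^{-1}\}$. Regard $U^{(\overline{e})}$ as a $U(\mathfrak{g})$-$U(\mathfrak{g})$-bimodule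 via $y\cdot u\cdot y'=\Theta_z(y)uy'$ for $y,y'\in U(\mathfrak{g})$, $u\in U^{(\overline{e})}$. Then $B_zM=U^{(\overline{e})}\otimes_{U(\mathfrak{g})}M$ with this bimodule structure. *)

theory Defs
  imports
    "HOL-Library.Poly_Mapping"
    "HOL-Computational_Algebra.Polynomial"
    "HOL-Algebra.Free_Abelian_Groups"
    "HOL-Algebra.Algebraic_Closure_Type"
begin

section \<open>Complex associative algebras given by generators and relations\<close>

class complex_algebra = ring + monoid_mult +
  fixes cscalar :: "complex \<Rightarrow> 'a"
  assumes cscalar_add: "cscalar (c + d) = cscalar c + cscalar d"
    and cscalar_mult: "cscalar (c * d) = cscalar c * cscalar d"
    and cscalar_one [simp]: "cscalar 1 = 1"
    and cscalar_central: "cscalar c * x = x * cscalar c"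
begin

lemma cscalar_0 [simp]: "cscalar 0 = 0"
  using cscalar_add[of 0 0] by simp

lemma cscalar_minus: "cscalar (- c) = - cscalar c"
  using cscalar_add[of c "- c"] by (simp add: eq_neg_iff_add_eq_0 add.commute)

end

definition is_algebra_hom :: "('a::complex_algebra \<Rightarrow> 'b::complex_algebra) \<Rightarrow> bool" where
  "is_algebra_hom \<phi> \<longleftrightarrow>
     (\<forall>x y. \<phi> (x + y) = \<phi> x + \<phi> y) \<and> (\<forall>x y. \<phi> (x * y) = \<phi> x * \<phi> y) \<and>
     (\<forall>c. \<phi> (cscalar c) = cscalar c)"

lemma is_algebra_homD:
  assumes "is_algebra_hom \<phi>"
  shows "\<phi> (x + y) = \<phi> x + \<phi> y" "\<phi> (x * y) = \<phi> x * \<phi> y" "\<phi> (cscalar c) = cscalar c"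
    "\<phi> 0 = 0" "\<phi> 1 = 1" "\<phi> (- x) = - \<phi> x" "\<phi> (x - y) = \<phi> x - \<phi> y"
proof -
  show *: "\<phi> (x + y) = \<phi> x + \<phi> y" "\<phi> (x * y) = \<phi> x * \<phi> y" "\<phi> (cscalar c) = cscalar c" for x y c
    using assms by (auto simp: is_algebra_hom_def)
  show 0: "\<phi> 0 = 0" using *(3)[of 0] by simp
  show "\<phi> 1 = 1" using *(3)[of 1] by simp
  show m: "\<phi> (- x) = - \<phi> x" for x
    using *(1)[of x "- x"] 0 by (simp add: eq_neg_iff_add_eq_0 add.commute)
  show "\<phi> (x - y) = \<phi> x - \<phi> y" using *(1)[of x "- y"] m[of y] by simp
qed

lemma is_algebra_hom_comp:
  "is_algebra_hom \<phi> \<Longrightarrow> is_algebra_hom \<psi> \<Longrightarrow> is_algebra_hom (\<lambda>x. \<phi> (\<psi> x))"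
  by (simp add: is_algebra_hom_def)

lemma is_algebra_hom_sum:
  "is_algebra_hom \<phi> \<Longrightarrow> \<phi> (sum f A) = (\<Sum>x\<in>A. \<phi> (f x))"
  by (induction A rule: infinite_finite_induct) (simp_all add: is_algebra_homD)

lemma is_algebra_hom_prod_list:
  "is_algebra_hom \<phi> \<Longrightarrow> \<phi> (prod_list xs) = prod_list (map \<phi> xs)"
  by (induction xs) (simp_all add: is_algebra_homD)

datatype 'x fword = Word (letters: "'x list")

instantiation fword :: (type) monoid_add
begin
definition zero_fword :: "'a fword" where "0 = Word []"
definition plus_fword :: "'a fword \<Rightarrow> 'a fword \<Rightarrow> 'a fword"
  where "v + w = Word (letters v @ letters w)"
instance by standard (auto simp: zero_fword_def plus_fword_def)
end

instantiation complex :: complex_algebra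
begin
definition cscalar_complex :: "complex \<Rightarrow> complex" where "cscalar_complex c = c"
instance by standard (auto simp: cscalar_complex_def)
end

lemma poly_mapping_single_induct [case_names zero add]:
  assumes "P 0" "\<And>k c p. P p \<Longrightarrow> P (Poly_Mapping.single k c + p)"
  shows "P p"
proof (induction p rule: update_induct)
  case const
  show ?case by fact
next
  case (update f a b)
  have "Poly_Mapping.update a b f = Poly_Mapping.single a b + f"
    using update(1) by (intro poly_mapping_eqI)
      (auto simp: lookup_update lookup_add lookup_single in_keys_iff when_def)
  with assms(2)[OF update(3)] show ?case by simp
qed

instantiation poly_mapping :: (monoid_add, "{complex_algebra, ring_1}") complex_algebra
begin
definition cscalar_poly_mapping :: "complex \<Rightarrow> 'a \<Rightarrow>\<^sub>0 'b"
  where "cscalar_poly_mapping c = Poly_Mapping.single 0 (cscalar c)"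
instance
proof
  fix c :: complex and x :: "'a \<Rightarrow>\<^sub>0 'b"
  show "cscalar c * x = x * cscalar c"
    unfolding cscalar_poly_mapping_def
    by (induction x rule: poly_mapping_single_induct)
       (simp_all add: distrib_left distrib_right mult_single cscalar_central)
qed (simp_all add: cscalar_poly_mapping_def cscalar_add cscalar_mult single_add mult_single)
end

text \<open>The free algebra on \<open>'x\<close> is the monoid algebra of the free monoid: the product on
  \<^typ>\<open>'x fword \<Rightarrow>\<^sub>0 complex\<close> is convolution along concatenation of words.\<close>

type_synonym 'x free_alg = "'x fword \<Rightarrow>\<^sub>0 complex"

definition gen :: "'x \<Rightarrow> 'x free_alg" where
  "gen x = Poly_Mapping.single (Word [x]) 1"

definition free_eval :: "('x \<Rightarrow> 'a::complex_algebra) \<Rightarrow> 'x free_alg \<Rightarrow> 'a" where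
  "free_eval f p = (\<Sum>w\<in>Poly_Mapping.keys p.
      cscalar (Poly_Mapping.lookup p w) * prod_list (map f (letters w)))"

lemma free_eval_superset:
  assumes "finite A" "Poly_Mapping.keys p \<subseteq> A"
  shows "free_eval f p = (\<Sum>w\<in>A. cscalar (Poly_Mapping.lookup p w) * prod_list (map f (letters w)))"
  unfolding free_eval_def
  by (rule sum.mono_neutral_left[OF assms]) (auto simp: in_keys_iff)

lemma free_eval_add: "free_eval f (p + q) = free_eval f p + free_eval f q"
proof -
  let ?A = "Poly_Mapping.keys p \<union> Poly_Mapping.keys q"
  have "Poly_Mapping.keys (p + q) \<subseteq> ?A" by (rule keys_add)
  then show ?thesis
    by (subst (1 2 3) free_eval_superset[of ?A])
       (auto simp: lookup_add cscalar_add distrib_right sum.distrib)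
qed

lemma free_eval_0 [simp]: "free_eval f 0 = 0"
  by (simp add: free_eval_def)

lemma free_eval_single:
  "free_eval f (Poly_Mapping.single w c) = cscalar c * prod_list (map f (letters w))"
  by (simp add: free_eval_def)

lemma free_eval_gen [simp]: "free_eval f (gen x) = f x"
  by (simp add: gen_def free_eval_single)

lemma free_eval_mult: "free_eval f (p * q) = free_eval f p * free_eval f q"
proof (induction p rule: poly_mapping_single_induct)
  case (add v c p)
  have "free_eval f (Poly_Mapping.single v c * q) = free_eval f (Poly_Mapping.single v c) * free_eval f q"
  proof (induction q rule: poly_mapping_single_induct)
    case (add w d q)
    have "cscalar (c * d) * (prod_list (map f (letters v)) * prod_list (map f (letters w))) =
      cscalar c * prod_list (map f (letters v)) * (cscalar d * prod_list (map f (letters w)))"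
      by (metis cscalar_central cscalar_mult mult.assoc)
    with add show ?case
      by (simp add: distrib_left free_eval_add mult_single free_eval_single plus_fword_def)
  qed simp
  with add show ?case by (simp add: distrib_right free_eval_add)
qed simp

lemma is_algebra_hom_free_eval: "is_algebra_hom (free_eval f)"
  by (simp add: is_algebra_hom_def free_eval_add free_eval_mult cscalar_poly_mapping_def
      cscalar_complex_def free_eval_single zero_fword_def)

lemma single_eq_free_eval:
  "Poly_Mapping.single w c = cscalar c * prod_list (map gen (letters w))"
proof -
  have "prod_list (map gen xs) = Poly_Mapping.single (Word xs) (1::complex)" for xs :: "'a list"
    by (induction xs) (simp_all add: gen_def mult_single plus_fword_def flip: single_one zero_fword_def)
  from this[of "letters w"] show ?thesis
    by (simp add: cscalar_poly_mapping_def cscalar_complex_def mult_single)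
qed

lemma algebra_hom_free_ext:
  assumes "is_algebra_hom \<phi>" "is_algebra_hom \<psi>" "\<And>x. \<phi> (gen x) = \<psi> (gen x)"
  shows "\<phi> (p :: 'x free_alg) = \<psi> p"
proof (induction p rule: poly_mapping_single_induct)
  case zero
  show ?case by (simp add: is_algebra_homD[OF assms(1)] is_algebra_homD[OF assms(2)])
next
  case (add k c p)
  have "\<phi> (Poly_Mapping.single k c) = \<psi> (Poly_Mapping.single k c)"
    by (simp add: single_eq_free_eval is_algebra_homD[OF assms(1)] is_algebra_homD[OF assms(2)]
        is_algebra_hom_prod_list[OF assms(1)] is_algebra_hom_prod_list[OF assms(2)] assms(3) o_def)
  with add show ?case by (simp add: is_algebra_homD[OF assms(1)] is_algebra_homD[OF assms(2)])
qed

definition rel_ideal :: "'a::ring_1 set \<Rightarrow> 'a set" where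
  "rel_ideal R = Idl\<^bsub>ring_of_type_algebra\<^esub> R"

lemma ring_ring_of_type_algebra: "ring (ring_of_type_algebra :: 'a::ring_1 ring)"
proof -
  have "\<exists>y. x + y = 0" for x :: 'a
    by (rule exI[of _ "- x"]) simp
  thus ?thesis
    unfolding ring_of_type_algebra_def using add.right_inverse
    by unfold_locales (auto simp: algebra_simps Units_def)
qed

lemma ideal_rel_ideal: "ideal (rel_ideal R) (ring_of_type_algebra :: 'a::ring_1 ring)"
  unfolding rel_ideal_def
  by (rule ring.genideal_ideal[OF ring_ring_of_type_algebra]) (simp add: ring_of_type_algebra_def)

lemma rel_ideal_closed:
  fixes x y :: "'a::ring_1"
  shows "0 \<in> rel_ideal R"
    and "x \<in> rel_ideal R \<Longrightarrow> y \<in> rel_ideal R \<Longrightarrow> x + y \<in> rel_ideal R"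
    and "x \<in> rel_ideal R \<Longrightarrow> a * x \<in> rel_ideal R"
    and "x \<in> rel_ideal R \<Longrightarrow> x * a \<in> rel_ideal R"
    and "x \<in> rel_ideal R \<Longrightarrow> - x \<in> rel_ideal R"
proof -
  interpret ideal "rel_ideal R" "ring_of_type_algebra :: 'a ring"
    by (rule ideal_rel_ideal)
  show "0 \<in> rel_ideal R"
    using additive_subgroup.zero_closed[OF is_additive_subgroup] by (simp add: ring_of_type_algebra_def)
  show "x \<in> rel_ideal R \<Longrightarrow> y \<in> rel_ideal R \<Longrightarrow> x + y \<in> rel_ideal R"
    using additive_subgroup.a_closed[OF is_additive_subgroup] by (simp add: ring_of_type_algebra_def)
  show l: "x \<in> rel_ideal R \<Longrightarrow> a * x \<in> rel_ideal R" for a x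
    using I_l_closed by (simp add: ring_of_type_algebra_def)
  show "x \<in> rel_ideal R \<Longrightarrow> x * a \<in> rel_ideal R"
    using I_r_closed by (simp add: ring_of_type_algebra_def)
  show "x \<in> rel_ideal R \<Longrightarrow> - x \<in> rel_ideal R"
    using l[of x "- 1"] by simp
qed

lemma rel_ideal_incl: "x \<in> R \<Longrightarrow> x \<in> rel_ideal R"
  by (auto simp: rel_ideal_def genideal_def)

lemma rel_ideal_hom_0:
  fixes \<phi> :: "'a::{complex_algebra, ring_1} \<Rightarrow> 'b::complex_algebra"
  assumes \<phi>: "is_algebra_hom \<phi>" and R: "\<And>x. x \<in> R \<Longrightarrow> \<phi> x = 0" and x: "x \<in> rel_ideal R"
  shows "\<phi> x = 0"
proof -
  note hom = is_algebra_homD[OF \<phi>]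
  let ?A = "ring_of_type_algebra :: 'a ring"
  interpret ring ?A by (rule ring_ring_of_type_algebra)
  have "ideal {x. \<phi> x = 0} ?A"
  proof (rule idealI[OF ring_ring_of_type_algebra])
    show "subgroup {x. \<phi> x = 0} (add_monoid ?A)"
    proof (rule group.subgroupI)
      show "Group.group (add_monoid ?A)" by (rule add.is_group)
      fix a assume "a \<in> {x. \<phi> x = 0}"
      moreover have "inv\<^bsub>add_monoid ?A\<^esub> a = - a"
        using add.inv_equality[of "- a" a]
        by (simp add: ring_of_type_algebra_def a_inv_def)
      ultimately show "inv\<^bsub>add_monoid ?A\<^esub> a \<in> {x. \<phi> x = 0}" by (simp add: hom)
    qed (auto simp: ring_of_type_algebra_def hom intro: exI[of _ 0])
  qed (auto simp: ring_of_type_algebra_def hom)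
  with R x show ?thesis by (auto simp: rel_ideal_def genideal_def)
qed

lemma equivp_rel_ideal: "equivp (\<lambda>x y. x - y \<in> rel_ideal R)"
proof (rule equivpI)
  show "reflp (\<lambda>x y. x - y \<in> rel_ideal R)" by (auto intro!: reflpI rel_ideal_closed)
  show "symp (\<lambda>x y. x - y \<in> rel_ideal R)"
    by (rule sympI) (use rel_ideal_closed(5) in fastforce)
  show "transp (\<lambda>x y. x - y \<in> rel_ideal R)"
    by (rule transpI) (use rel_ideal_closed(2) in fastforce)
qed

lemma rel_ideal_cong:
  fixes x y x' y' :: "'a::ring_1"
  assumes "x - x' \<in> rel_ideal R" "y - y' \<in> rel_ideal R"
  shows "(x + y) - (x' + y') \<in> rel_ideal R" "(x - y) - (x' - y') \<in> rel_ideal R"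
    "x * y - x' * y' \<in> rel_ideal R"
proof -
  have "(x + y) - (x' + y') = (x - x') + (y - y')" by simp
  with assms show "(x + y) - (x' + y') \<in> rel_ideal R" by (simp only: rel_ideal_closed(2))
  have "(x - y) - (x' - y') = (x - x') + - (y - y')" by simp
  with assms show "(x - y) - (x' - y') \<in> rel_ideal R" by (simp only: rel_ideal_closed(2,5))
  have "x * y - x' * y' = (x - x') * y + x' * (y - y')" by (simp add: algebra_simps)
  with assms show "x * y - x' * y' \<in> rel_ideal R" by (simp only: rel_ideal_closed)
qed

lemma rel_ideal_cong_uminus:
  fixes x x' :: "'a::ring_1"
  assumes "x - x' \<in> rel_ideal R"
  shows "- x - - x' \<in> rel_ideal R"
  using rel_ideal_closed(5)[OF assms] by simp

section \<open>The Takiff Lie algebra of $\mathfrak{sl}_2$\<close>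

datatype sl2_basis = E | H | F

text \<open>$\mathfrak{sl}_2$ is the space with standard basis $e, h, f$; \<open>Base x\<close> is \<open>x \<otimes> 1\<close> and \<open>Bar x\<close> is \<open>x \<otimes> t\<close>.\<close>

datatype takiff_basis = Base sl2_basis | Bar sl2_basis

lemma UNIV_sl2_basis: "UNIV = {E, H, F}"
  by (auto intro: sl2_basis.exhaust)

lemma UNIV_takiff_basis: "UNIV = {Base E, Base H, Base F, Bar E, Bar H, Bar F}"
proof -
  have "x \<in> {Base E, Base H, Base F, Bar E, Bar H, Bar F}" for x
    by (cases x rule: takiff_basis.exhaust) (auto, (metis sl2_basis.exhaust)+)
  then show ?thesis by blast
qed

instance sl2_basis :: finite
  by standard (simp add: UNIV_sl2_basis)

instance takiff_basis :: finite
  by standard (simp add: UNIV_takiff_basis)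

type_synonym sl2 = "sl2_basis \<Rightarrow>\<^sub>0 complex"
type_synonym takiff = "takiff_basis \<Rightarrow>\<^sub>0 complex"

fun sl2_bracket_basis :: "sl2_basis \<Rightarrow> sl2_basis \<Rightarrow> sl2" where
  "sl2_bracket_basis E F = Poly_Mapping.single H 1"
| "sl2_bracket_basis F E = Poly_Mapping.single H (-1)"
| "sl2_bracket_basis H E = Poly_Mapping.single E 2"
| "sl2_bracket_basis E H = Poly_Mapping.single E (-2)"
| "sl2_bracket_basis H F = Poly_Mapping.single F (-2)"
| "sl2_bracket_basis F H = Poly_Mapping.single F 2"
| "sl2_bracket_basis _ _ = 0"

definition tensor_1 :: "sl2 \<Rightarrow> takiff" where
  "tensor_1 x = (\<Sum>k\<in>UNIV. Poly_Mapping.single (Base k) (Poly_Mapping.lookup x k))"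

definition tensor_t :: "sl2 \<Rightarrow> takiff" where
  "tensor_t x = (\<Sum>k\<in>UNIV. Poly_Mapping.single (Bar k) (Poly_Mapping.lookup x k))"

fun takiff_bracket_basis :: "takiff_basis \<Rightarrow> takiff_basis \<Rightarrow> takiff" where
  "takiff_bracket_basis (Base x) (Base y) = tensor_1 (sl2_bracket_basis x y)"
| "takiff_bracket_basis (Base x) (Bar y) = tensor_t (sl2_bracket_basis x y)"
| "takiff_bracket_basis (Bar x) (Base y) = tensor_t (sl2_bracket_basis x y)"
| "takiff_bracket_basis (Bar x) (Bar y) = 0"

definition takiff_scale :: "complex \<Rightarrow> takiff \<Rightarrow> takiff" where
  "takiff_scale c = Poly_Mapping.map ((*) c)"

definition takiff_bracket :: "takiff \<Rightarrow> takiff \<Rightarrow> takiff" where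
  "takiff_bracket p q = (\<Sum>x\<in>UNIV. \<Sum>y\<in>UNIV.
     takiff_scale (Poly_Mapping.lookup p x * Poly_Mapping.lookup q y) (takiff_bracket_basis x y))"

section \<open>The enveloping algebra and its localization\<close>

definition takiff_lin :: "(takiff_basis \<Rightarrow> 'a::complex_algebra) \<Rightarrow> takiff \<Rightarrow> 'a" where
  "takiff_lin g y = (\<Sum>x\<in>UNIV. cscalar (Poly_Mapping.lookup y x) * g x)"

definition takiff_relators :: "(takiff_basis \<Rightarrow> 'a::complex_algebra) \<Rightarrow> 'a set" where
  "takiff_relators g =
     {g x * g y - g y * g x - takiff_lin g (takiff_bracket_basis x y) | x y. True}"

quotient_type env = "takiff_basis free_alg" /
  "\<lambda>p q. p - q \<in> rel_ideal (takiff_relators gen)"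
  by (rule equivp_rel_ideal)

datatype loc_symbol = Lie takiff_basis | Ebar_inv

definition loc_relators :: "loc_symbol free_alg set" where
  "loc_relators = takiff_relators (\<lambda>x. gen (Lie x)) \<union>
     {gen Ebar_inv * gen (Lie (Bar E)) - 1, gen (Lie (Bar E)) * gen Ebar_inv - 1}"

quotient_type loc = "loc_symbol free_alg" / "\<lambda>p q. p - q \<in> rel_ideal loc_relators"
  by (rule equivp_rel_ideal)

instantiation env :: complex_algebra
begin
lift_definition zero_env :: env is 0 .
lift_definition one_env :: env is 1 .
lift_definition plus_env :: "env \<Rightarrow> env \<Rightarrow> env" is "(+)" by (rule rel_ideal_cong)
lift_definition minus_env :: "env \<Rightarrow> env \<Rightarrow> env" is "(-)" by (rule rel_ideal_cong)
lift_definition times_env :: "env \<Rightarrow> env \<Rightarrow> env" is "(*)" by (rule rel_ideal_cong)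
lift_definition uminus_env :: "env \<Rightarrow> env" is "uminus" by (rule rel_ideal_cong_uminus)
lift_definition cscalar_env :: "complex \<Rightarrow> env" is cscalar .
instance
  by standard (transfer;
      simp add: algebra_simps rel_ideal_closed cscalar_add cscalar_mult;
      simp only: cscalar_central diff_self rel_ideal_closed)+
end

instantiation loc :: complex_algebra
begin
lift_definition zero_loc :: loc is 0 .
lift_definition one_loc :: loc is 1 .
lift_definition plus_loc :: "loc \<Rightarrow> loc \<Rightarrow> loc" is "(+)" by (rule rel_ideal_cong)
lift_definition minus_loc :: "loc \<Rightarrow> loc \<Rightarrow> loc" is "(-)" by (rule rel_ideal_cong)
lift_definition times_loc :: "loc \<Rightarrow> loc \<Rightarrow> loc" is "(*)" by (rule rel_ideal_cong)
lift_definition uminus_loc :: "loc \<Rightarrow> loc" is "uminus" by (rule rel_ideal_cong_uminus)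
lift_definition cscalar_loc :: "complex \<Rightarrow> loc" is cscalar .
instance
  by standard (transfer;
      simp add: algebra_simps rel_ideal_closed cscalar_add cscalar_mult;
      simp only: cscalar_central diff_self rel_ideal_closed)+
end

lift_definition env_gen :: "takiff_basis \<Rightarrow> env" is gen .

lift_definition loc_gen :: "loc_symbol \<Rightarrow> loc" is gen .

abbreviation loc_lie :: "takiff_basis \<Rightarrow> loc" where
  "loc_lie x \<equiv> loc_gen (Lie x)"

lemma is_algebra_hom_abs_loc: "is_algebra_hom abs_loc"
  by (simp add: is_algebra_hom_def plus_loc.abs_eq times_loc.abs_eq cscalar_loc.abs_eq)

lemma is_algebra_hom_abs_env: "is_algebra_hom abs_env"
  by (simp add: is_algebra_hom_def plus_env.abs_eq times_env.abs_eq cscalar_env.abs_eq)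

lemma algebra_hom_takiff_lin:
  "is_algebra_hom \<phi> \<Longrightarrow> \<phi> (takiff_lin g y) = takiff_lin (\<lambda>x. \<phi> (g x)) y"
  by (simp add: takiff_lin_def is_algebra_hom_sum is_algebra_homD)

lemma abs_loc_eq_0: "p \<in> rel_ideal loc_relators \<Longrightarrow> abs_loc p = 0"
  by (simp add: zero_loc_def loc.abs_eq_iff)

lemma loc_lie_commutator:
  "loc_lie x * loc_lie y - loc_lie y * loc_lie x = takiff_lin loc_lie (takiff_bracket_basis x y)"
proof -
  note hom = is_algebra_homD[OF is_algebra_hom_abs_loc]
  have "gen (Lie x) * gen (Lie y) - gen (Lie y) * gen (Lie x) -
      takiff_lin (\<lambda>x. gen (Lie x)) (takiff_bracket_basis x y) \<in> rel_ideal loc_relators"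
    by (rule rel_ideal_incl) (auto simp: loc_relators_def takiff_relators_def)
  from abs_loc_eq_0[OF this] show ?thesis
    by (simp add: hom algebra_hom_takiff_lin[OF is_algebra_hom_abs_loc] loc_gen.abs_eq)
qed

lemma loc_Ebar_inv:
  "loc_gen Ebar_inv * loc_lie (Bar E) = 1" "loc_lie (Bar E) * loc_gen Ebar_inv = 1"
proof -
  note hom = is_algebra_homD[OF is_algebra_hom_abs_loc]
  have "gen Ebar_inv * gen (Lie (Bar E)) - 1 \<in> rel_ideal loc_relators"
    "gen (Lie (Bar E)) * gen Ebar_inv - 1 \<in> rel_ideal loc_relators"
    by (auto intro!: rel_ideal_incl simp: loc_relators_def)
  from this[THEN abs_loc_eq_0] show
    "loc_gen Ebar_inv * loc_lie (Bar E) = 1" "loc_lie (Bar E) * loc_gen Ebar_inv = 1"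
    by (simp_all add: hom loc_gen.abs_eq)
qed

text \<open>The localization map $U(\mathfrak{g}) \to U^{(\overline{e})}$.\<close>

lift_definition localize :: "env \<Rightarrow> loc" is "free_eval loc_lie"
proof -
  fix p q :: "takiff_basis free_alg"
  note hom = is_algebra_hom_free_eval[of loc_lie]
  assume "p - q \<in> rel_ideal (takiff_relators gen)"
  then have "free_eval loc_lie (p - q) = 0"
    by (rule rel_ideal_hom_0[OF hom, rotated])
       (auto simp: takiff_relators_def is_algebra_homD[OF hom] algebra_hom_takiff_lin[OF hom]
         loc_lie_commutator)
  then show "free_eval loc_lie p = free_eval loc_lie q"
    by (simp add: is_algebra_homD[OF hom])
qed

definition is_Theta :: "complex \<Rightarrow> (loc \<Rightarrow> loc) \<Rightarrow> bool" where
  "is_Theta z \<theta> \<longleftrightarrow> is_algebra_hom \<theta> \<and> bij \<theta> \<and>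
     \<theta> (loc_lie (Base F)) = loc_lie (Base F) - cscalar z * loc_gen Ebar_inv * loc_lie (Bar H) \<and>
     \<theta> (loc_lie (Base H)) = loc_lie (Base H) + cscalar (2 * z) \<and>
     (\<forall>g \<in> {Lie (Bar F), Lie (Bar H), Lie (Bar E), Lie (Base E), Ebar_inv}.
        \<theta> (loc_gen g) = loc_gen g)"

lemma abs_loc_rep: "abs_loc (rep_loc u) = u"
  by (rule Quotient_abs_rep[OF Quotient_loc])

lemma hom_loc_ext:
  assumes "is_algebra_hom \<phi>" "is_algebra_hom \<psi>" "\<And>g. \<phi> (loc_gen g) = \<psi> (loc_gen g)"
  shows "\<phi> = \<psi>"
proof
  fix u
  obtain p where u: "u = abs_loc p" by (metis abs_loc_rep)
  have "\<phi> (abs_loc p) = \<psi> (abs_loc p)"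
    by (rule algebra_hom_free_ext[OF is_algebra_hom_comp[OF assms(1) is_algebra_hom_abs_loc]
          is_algebra_hom_comp[OF assms(2) is_algebra_hom_abs_loc]])
       (use assms(3) in \<open>simp add: loc_gen.abs_eq\<close>)
  then show "\<phi> u = \<psi> u" by (simp add: u)
qed

lemma loc_hom_exists:
  fixes f :: "loc_symbol \<Rightarrow> 'a::complex_algebra"
  assumes "\<And>x y. f (Lie x) * f (Lie y) - f (Lie y) * f (Lie x) =
      takiff_lin (\<lambda>k. f (Lie k)) (takiff_bracket_basis x y)"
    and "f Ebar_inv * f (Lie (Bar E)) = 1" "f (Lie (Bar E)) * f Ebar_inv = 1"
  obtains \<phi> where "is_algebra_hom \<phi>" "\<And>g. \<phi> (loc_gen g) = f g"
proof -
  note hom = is_algebra_hom_free_eval[of f]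
  have 0: "free_eval f p = 0" if "p \<in> rel_ideal loc_relators" for p
    by (rule rel_ideal_hom_0[OF hom _ that])
       (use assms in \<open>auto simp: loc_relators_def takiff_relators_def is_algebra_homD[OF hom]
         algebra_hom_takiff_lin[OF hom]\<close>)
  have abs: "free_eval f (rep_loc (abs_loc p)) = free_eval f p" for p
  proof -
    have "rep_loc (abs_loc p) - p \<in> rel_ideal loc_relators"
      using abs_loc_rep[of "abs_loc p"] by (simp add: loc.abs_eq_iff)
    from 0[OF this] show ?thesis by (simp add: is_algebra_homD[OF hom])
  qed
  have surj: "\<exists>p. u = abs_loc p" for u by (metis abs_loc_rep)
  show thesis
  proof
    show "is_algebra_hom (\<lambda>u. free_eval f (rep_loc u))"
      unfolding is_algebra_hom_def
    proof (intro conjI allI)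
      fix u v c
      obtain p q where uv: "u = abs_loc p" "v = abs_loc q" using surj by metis
      note homs = is_algebra_homD[OF is_algebra_hom_abs_loc, symmetric]
      show "free_eval f (rep_loc (u + v)) = free_eval f (rep_loc u) + free_eval f (rep_loc v)"
        unfolding uv homs abs by (rule is_algebra_homD[OF hom])
      show "free_eval f (rep_loc (u * v)) = free_eval f (rep_loc u) * free_eval f (rep_loc v)"
        unfolding uv homs abs by (rule is_algebra_homD[OF hom])
      show "free_eval f (rep_loc (cscalar c)) = cscalar c"
        unfolding homs abs by (rule is_algebra_homD[OF hom])
    qed
    show "free_eval f (rep_loc (loc_gen g)) = f g" for g
      by (simp add: loc_gen.abs_eq abs)
  qed
qed

lemma is_Theta_unique:
  assumes "is_Theta z \<phi>" "is_Theta z \<psi>"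
  shows "\<phi> = \<psi>"
proof (rule hom_loc_ext)
  fix g
  show "\<phi> (loc_gen g) = \<psi> (loc_gen g)"
  proof (cases g)
    case (Lie x)
    have "x \<in> {Base E, Base H, Base F, Bar E, Bar H, Bar F}"
      using UNIV_takiff_basis by blast
    with assms show ?thesis by (auto simp: Lie is_Theta_def)
  qed (use assms in \<open>auto simp: is_Theta_def\<close>)
qed (use assms in \<open>auto simp: is_Theta_def\<close>)

lemma takiff_lin_bracket:
  "takiff_lin g (tensor_1 q) = (\<Sum>k\<in>UNIV. cscalar (Poly_Mapping.lookup q k) * g (Base k))"
  "takiff_lin g (tensor_t q) = (\<Sum>k\<in>UNIV. cscalar (Poly_Mapping.lookup q k) * g (Bar k))"
  "takiff_lin g 0 = 0"
  by (simp_all add: takiff_lin_def UNIV_takiff_basis UNIV_sl2_basis tensor_1_def tensor_t_def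
      lookup_add lookup_single)

lemma Theta_exists_hom:
  "\<exists>\<theta>. is_algebra_hom \<theta> \<and>
     \<theta> (loc_lie (Base F)) = loc_lie (Base F) - cscalar z * loc_gen Ebar_inv * loc_lie (Bar H) \<and>
     \<theta> (loc_lie (Base H)) = loc_lie (Base H) + cscalar (2 * z) \<and>
     (\<forall>g \<in> {Lie (Bar F), Lie (Bar H), Lie (Bar E), Lie (Base E), Ebar_inv}.
        \<theta> (loc_gen g) = loc_gen g)"
proof -
  define v where "v = loc_gen Ebar_inv"
  define c where "c = (cscalar z :: loc)"
  define F' where "F' = loc_lie (Base F) - c * v * loc_lie (Bar H)"
  define f where "f = (\<lambda>g. if g = Lie (Base F) then F'
     else if g = Lie (Base H) then loc_lie (Base H) + cscalar (2 * z) else loc_gen g)"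
  note comm = loc_lie_commutator
  have v: "v * loc_lie (Bar E) = 1" "loc_lie (Bar E) * v = 1"
    unfolding v_def by (rule loc_Ebar_inv)+
  have two: "cscalar 2 = (1 + 1 ::loc)" using cscalar_add[of 1 1, where ?'a=loc] by simp
  have cz: "cscalar (2 * z) = c + c"
    by (simp only: c_def mult_2 cscalar_add)
  have cc: "x * c = c * x" for x :: loc
    unfolding c_def by (rule cscalar_central[symmetric])
  have Ftilde: "x * F' - F' * x = (x * loc_lie (Base F) - loc_lie (Base F) * x)
      - c * (x * v * loc_lie (Bar H) - v * loc_lie (Bar H) * x)" for x
  proof -
    have xc: "x * (c * w) = c * (x * w)" for w by (simp add: cc[of x] flip: mult.assoc)
    show ?thesis
      unfolding F'_def by (simp add: right_diff_distrib left_diff_distrib mult.assoc xc)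
  qed
  have xv: "x * v - v * x = - (v * (x * loc_lie (Bar E) - loc_lie (Bar E) * x) * v)" for x
  proof -
    have "v * (x * loc_lie (Bar E) - loc_lie (Bar E) * x) * v =
      v * x * (loc_lie (Bar E) * v) - (v * loc_lie (Bar E)) * x * v"
      by (simp add: right_diff_distrib left_diff_distrib mult.assoc)
    then show ?thesis by (simp add: v)
  qed
  have xvH: "x * v * loc_lie (Bar H) - v * loc_lie (Bar H) * x =
      (x * v - v * x) * loc_lie (Bar H) + v * (x * loc_lie (Bar H) - loc_lie (Bar H) * x)" for x
    by (simp add: algebra_simps)
  have FE: "x * F' - F' * x = (x * loc_lie (Base F) - loc_lie (Base F) * x)
      - c * (- (v * (x * loc_lie (Bar E) - loc_lie (Bar E) * x) * v) * loc_lie (Bar H)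
             + v * (x * loc_lie (Bar H) - loc_lie (Bar H) * x))" for x
    unfolding Ftilde xvH xv ..
  have v': "v * (loc_lie (Bar E) * w) = w" "loc_lie (Bar E) * (v * w) = w" for w
    by (simp_all add: v flip: mult.assoc)
  have F1: "loc_lie (Base H) * F' - F' * loc_lie (Base H) = - (F' + F')"
    unfolding FE comm by (simp add: takiff_lin_bracket UNIV_sl2_basis lookup_single two cscalar_minus
        distrib_left distrib_right left_diff_distrib right_diff_distrib mult.assoc v v' F'_def)
  have F2: "loc_lie (Base E) * F' - F' * loc_lie (Base E) = loc_lie (Base H) + cscalar (2 * z)"
    unfolding FE comm by (simp add: takiff_lin_bracket UNIV_sl2_basis lookup_single two cscalar_minus
        distrib_left distrib_right left_diff_distrib right_diff_distrib mult.assoc v v' cz)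
  have F3: "loc_lie (Bar H) * F' - F' * loc_lie (Bar H) = - (loc_lie (Bar F) + loc_lie (Bar F))"
    unfolding FE comm by (simp add: takiff_lin_bracket UNIV_sl2_basis lookup_single two cscalar_minus
        distrib_left distrib_right left_diff_distrib right_diff_distrib mult.assoc v v')
  have F4: "loc_lie (Bar F) * F' - F' * loc_lie (Bar F) = 0"
    unfolding FE comm by (simp add: takiff_lin_bracket UNIV_sl2_basis lookup_single two cscalar_minus
        distrib_left distrib_right left_diff_distrib right_diff_distrib mult.assoc v v')
  have F5: "loc_lie (Bar E) * F' - F' * loc_lie (Bar E) = loc_lie (Bar H)"
    unfolding FE comm by (simp add: takiff_lin_bracket UNIV_sl2_basis lookup_single two cscalar_minus
        distrib_left distrib_right left_diff_distrib right_diff_distrib mult.assoc v v')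
  have H1: "x * (loc_lie (Base H) + cscalar (2 * z)) - (loc_lie (Base H) + cscalar (2 * z)) * x
     = x * loc_lie (Base H) - loc_lie (Base H) * x" for x :: loc
    using cscalar_central[of "2 * z" x] by (simp add: distrib_left distrib_right left_diff_distrib right_diff_distrib)
  have H2: "(loc_lie (Base H) + cscalar (2 * z)) * x - x * (loc_lie (Base H) + cscalar (2 * z))
     = loc_lie (Base H) * x - x * loc_lie (Base H)" for x :: loc
    using cscalar_central[of "2 * z" x] by (simp add: distrib_left distrib_right left_diff_distrib right_diff_distrib)
  have F1': "(loc_lie (Base H) + cscalar (2 * z)) * F' - F' * (loc_lie (Base H) + cscalar (2 * z)) = - (F' + F')"
    unfolding H2 by (rule F1)
  have neg: "F' * x - x * F' = - (x * F' - F' * x)" for x by simp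
  have all: "x \<in> {Base E, Base H, Base F, Bar E, Bar H, Bar F}" for x
    using UNIV_takiff_basis by blast
  have "f (Lie x) * f (Lie y) - f (Lie y) * f (Lie x) =
      takiff_lin (\<lambda>k. f (Lie k)) (takiff_bracket_basis x y)" for x y
  proof -
    consider "x = Base F" | "x = Base H" | "x \<noteq> Base F" "x \<noteq> Base H" by blast
    then show ?thesis
    proof cases
      case 1
      have fx: "f (Lie x) = F'" by (simp add: f_def 1)
      show ?thesis unfolding fx using all[of y] unfolding neg[of "f (Lie y)"] 1
        by (elim insertE emptyE)
           (simp_all only: f_def loc_symbol.inject takiff_basis.inject takiff_basis.distinct
             sl2_basis.distinct if_True if_False simp_thms F1' F2 F3 F4 F5,
            simp_all add: takiff_lin_bracket UNIV_sl2_basis lookup_single two cscalar_minus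
              distrib_left distrib_right left_diff_distrib right_diff_distrib)
    next
      case 2
      have fx: "f (Lie x) = loc_lie (Base H) + cscalar (2 * z)" by (simp add: f_def 2)
      show ?thesis unfolding fx H2
      proof (cases "y = Base F")
        case True
        show "loc_lie (Base H) * f (Lie y) - f (Lie y) * loc_lie (Base H) = takiff_lin (\<lambda>k. f (Lie k)) (takiff_bracket_basis x y)"
          unfolding 2 True by (simp add: f_def F1 takiff_lin_bracket UNIV_sl2_basis lookup_single two cscalar_minus distrib_right left_diff_distrib right_diff_distrib)
      next
        case False
        have "loc_lie (Base H) * f (Lie y) - f (Lie y) * loc_lie (Base H) =
          loc_lie (Base H) * loc_lie y - loc_lie y * loc_lie (Base H)"
          using False by (auto simp: f_def H1)
        then show "loc_lie (Base H) * f (Lie y) - f (Lie y) * loc_lie (Base H) = takiff_lin (\<lambda>k. f (Lie k)) (takiff_bracket_basis x y)"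
          unfolding comm 2 using all[of y] False
          by (auto simp: f_def takiff_lin_bracket UNIV_sl2_basis lookup_single)
      qed
    next
      case 3
      then have fx: "f (Lie x) = loc_lie x" by (simp add: f_def)
      show ?thesis
      proof (cases "y = Base F")
        case True
        then have fy: "f (Lie y) = F'" by (simp add: f_def)
        show ?thesis unfolding fx fy unfolding True using all[of x] 3
          by (elim insertE emptyE; hypsubst)
             (simp_all only: F2 F3 F4 F5 simp_thms, simp_all add: f_def
               takiff_lin_bracket UNIV_sl2_basis lookup_single two cscalar_minus distrib_right left_diff_distrib right_diff_distrib)
      next
        case False
        have "loc_lie x * f (Lie y) - f (Lie y) * loc_lie x = loc_lie x * loc_lie y - loc_lie y * loc_lie x"
          using False by (auto simp: f_def H1)
        then show ?thesis
          unfolding fx comm using all[of y] all[of x] 3 False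
          by (elim insertE emptyE; hypsubst) (simp_all add: f_def takiff_lin_bracket UNIV_sl2_basis lookup_single)
      qed
    qed
  qed
  then obtain \<phi> where "is_algebra_hom \<phi>" "\<And>g. \<phi> (loc_gen g) = f g"
    by (rule loc_hom_exists) (auto simp: f_def v[unfolded v_def])
  then show ?thesis by (intro exI[of _ \<phi>]) (simp add: f_def F'_def c_def v_def)
qed

lemma is_Theta_exists: "\<exists>\<theta>. is_Theta z \<theta>"
proof -
  obtain \<theta> where t: "is_algebra_hom \<theta>"
     "\<theta> (loc_lie (Base F)) = loc_lie (Base F) - cscalar z * loc_gen Ebar_inv * loc_lie (Bar H)"
     "\<theta> (loc_lie (Base H)) = loc_lie (Base H) + cscalar (2 * z)"
     "\<forall>g \<in> {Lie (Bar F), Lie (Bar H), Lie (Bar E), Lie (Base E), Ebar_inv}. \<theta> (loc_gen g) = loc_gen g"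
    using Theta_exists_hom[of z] by blast
  obtain \<rho> where r: "is_algebra_hom \<rho>"
     "\<rho> (loc_lie (Base F)) = loc_lie (Base F) - cscalar (-z) * loc_gen Ebar_inv * loc_lie (Bar H)"
     "\<rho> (loc_lie (Base H)) = loc_lie (Base H) + cscalar (2 * -z)"
     "\<forall>g \<in> {Lie (Bar F), Lie (Bar H), Lie (Bar E), Lie (Base E), Ebar_inv}. \<rho> (loc_gen g) = loc_gen g"
    using Theta_exists_hom[of "-z"] by blast
  have id: "is_algebra_hom (\<lambda>x. x)" by (simp add: is_algebra_hom_def)
  have "x \<in> {Base E, Base H, Base F, Bar E, Bar H, Bar F}" for x
    using UNIV_takiff_basis by blast
  then have sym: "g \<in> {Lie (Base E), Lie (Base H), Lie (Base F), Lie (Bar E), Lie (Bar H), Lie (Bar F), Ebar_inv}" for g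
    by (cases g) auto
  have "(\<lambda>x. \<theta> (\<rho> x)) = (\<lambda>x. x)"
  proof (rule hom_loc_ext[OF is_algebra_hom_comp[OF t(1) r(1)] id])
    show "\<theta> (\<rho> (loc_gen g)) = loc_gen g" for g
      using sym[of g] t r by (auto simp: is_algebra_homD[OF t(1)] cscalar_minus)
  qed
  moreover have "(\<lambda>x. \<rho> (\<theta> x)) = (\<lambda>x. x)"
  proof (rule hom_loc_ext[OF is_algebra_hom_comp[OF r(1) t(1)] id])
    show "\<rho> (\<theta> (loc_gen g)) = loc_gen g" for g
      using sym[of g] t r by (auto simp: is_algebra_homD[OF r(1)] cscalar_minus)
  qed
  ultimately have "bij \<theta>" 
    by (intro o_bij[of \<rho> \<theta>]) (auto simp: fun_eq_iff)
  with t show ?thesis unfolding is_Theta_def by blast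
qed

lemma Theta_well_defined: "\<exists>!\<theta>. is_Theta z \<theta>"
  using is_Theta_exists is_Theta_unique by blast

definition Theta :: "complex \<Rightarrow> loc \<Rightarrow> loc" where
  "Theta z = (THE \<theta>. is_Theta z \<theta>)"

section \<open>Modules over the Takiff algebra\<close>

record 'v gmodule = "(complex, 'v) module" +
  gact :: "takiff \<Rightarrow> 'v \<Rightarrow> 'v"

locale takiff_module = module "ring_of_type_algebra :: complex ring" M
  for M :: "'v gmodule" (structure) +
  assumes gact_closed: "v \<in> carrier M \<Longrightarrow> gact M x v \<in> carrier M"
    and gact_add: "\<lbrakk>v \<in> carrier M; w \<in> carrier M\<rbrakk> \<Longrightarrow>
      gact M x (v \<oplus>\<^bsub>M\<^esub> w) = gact M x v \<oplus>\<^bsub>M\<^esub> gact M x w"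
    and gact_smult: "v \<in> carrier M \<Longrightarrow> gact M x (c \<odot>\<^bsub>M\<^esub> v) = c \<odot>\<^bsub>M\<^esub> gact M x v"
    and add_gact: "v \<in> carrier M \<Longrightarrow> gact M (x + y) v = gact M x v \<oplus>\<^bsub>M\<^esub> gact M y v"
    and scale_gact: "v \<in> carrier M \<Longrightarrow> gact M (takiff_scale c x) v = c \<odot>\<^bsub>M\<^esub> gact M x v"
    and bracket_gact: "v \<in> carrier M \<Longrightarrow>
      gact M (takiff_bracket x y) v = gact M x (gact M y v) \<ominus>\<^bsub>M\<^esub> gact M y (gact M x v)"

text \<open>That both sides are $\mathfrak{g}$-modules is part of the relation.\<close>

definition gmodule_iso :: "'v gmodule \<Rightarrow> 'w gmodule \<Rightarrow> bool" (infix \<open>\<cong>\<^sub>g\<close> 50) where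
  "M \<cong>\<^sub>g N \<longleftrightarrow> takiff_module M \<and> takiff_module N \<and>
     (\<exists>\<phi>. bij_betw \<phi> (carrier M) (carrier N) \<and>
       (\<forall>v\<in>carrier M. \<forall>w\<in>carrier M. \<phi> (v \<oplus>\<^bsub>M\<^esub> w) = \<phi> v \<oplus>\<^bsub>N\<^esub> \<phi> w) \<and>
       (\<forall>c. \<forall>v\<in>carrier M. \<phi> (c \<odot>\<^bsub>M\<^esub> v) = c \<odot>\<^bsub>N\<^esub> \<phi> v) \<and>
       (\<forall>x. \<forall>v\<in>carrier M. \<phi> (gact M x v) = gact N x (\<phi> v)))"

text \<open>The full linear dual. Functionals are made extensional, so that equality of functionals
  on \<open>carrier M\<close> is equality in HOL. The record fields \<open>mult\<close> and \<open>one\<close> of a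
  \<^typ>\<open>('a, 'b) module\<close> carry no meaning for modules.\<close>

definition dual :: "'v gmodule \<Rightarrow> ('v \<Rightarrow> complex) gmodule" where
  "dual M = \<lparr>
     carrier = {\<phi> \<in> extensional (carrier M).
       (\<forall>v\<in>carrier M. \<forall>w\<in>carrier M. \<phi> (v \<oplus>\<^bsub>M\<^esub> w) = \<phi> v + \<phi> w) \<and>
       (\<forall>c. \<forall>v\<in>carrier M. \<phi> (c \<odot>\<^bsub>M\<^esub> v) = c * \<phi> v)},
     monoid.mult = undefined, one = undefined,
     ring.zero = (\<lambda>v\<in>carrier M. 0),
     add = (\<lambda>\<phi> \<psi>. \<lambda>v\<in>carrier M. \<phi> v + \<psi> v),
     module.smult = (\<lambda>c \<phi>. \<lambda>v\<in>carrier M. c * \<phi> v),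
     gact = (\<lambda>y \<phi>. \<lambda>v\<in>carrier M. - \<phi> (gact M y v))\<rparr>"

definition linear_span :: "'v gmodule \<Rightarrow> 'v set \<Rightarrow> 'v set" where
  "linear_span M S =
     \<Inter>{N. submodule N (ring_of_type_algebra :: complex ring) M \<and> S \<subseteq> N}"

section \<open>The modules $\Gamma(\lambda,a,b)$ and $M_{\alpha,\beta}^{\lambda,a,b}$\<close>

text \<open>$\mathbb{C}[h,\overline{h}]$ is represented as $\mathbb{C}[h][\overline{h}]$: the outer
  variable is $\overline{h}$, so $\partial/\partial\overline{h}$ is \<^const>\<open>pderiv\<close>.\<close>

type_synonym hpoly = "complex poly poly"

definition cpoly :: "complex \<Rightarrow> hpoly" where "cpoly c = [:[:c:]:]"
definition hvar :: hpoly where "hvar = [:[:0, 1:]:]"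
definition hbar :: hpoly where "hbar = [:0, 1:]"

text \<open>\<open>shift c \<gamma>\<close> is $\gamma(h + c, \overline{h})$.\<close>

definition shift :: "complex \<Rightarrow> hpoly \<Rightarrow> hpoly" where
  "shift c = map_poly (\<lambda>p. pcompose p [:c, 1:])"

fun Gamma_act :: "complex \<Rightarrow> complex \<Rightarrow> complex \<Rightarrow> takiff_basis \<Rightarrow> hpoly \<Rightarrow> hpoly" where
  "Gamma_act lam a b (Base H) \<gamma> = hvar * \<gamma>"
| "Gamma_act lam a b (Bar H) \<gamma> = hbar * \<gamma>"
| "Gamma_act lam a b (Base E) \<gamma> = cpoly (- 2 * lam) * pderiv (shift (- 2) \<gamma>)"
| "Gamma_act lam a b (Bar E) \<gamma> = cpoly lam * shift (- 2) \<gamma>"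
| "Gamma_act lam a b (Bar F) \<gamma> = cpoly (- 1 / (4 * lam)) * (hbar\<^sup>2 + cpoly a) * shift 2 \<gamma>"
| "Gamma_act lam a b (Base F) \<gamma> =
     cpoly (- 1 / (2 * lam)) * ((hvar + cpoly 2) * hbar + cpoly b) * shift 2 \<gamma>
     + cpoly (- 1 / (2 * lam)) * (hbar\<^sup>2 + cpoly a) * pderiv (shift 2 \<gamma>)"

definition Gamma :: "complex \<Rightarrow> complex \<Rightarrow> complex \<Rightarrow> hpoly gmodule" where
  "Gamma lam a b = \<lparr>
     carrier = UNIV, monoid.mult = undefined, one = undefined,
     ring.zero = 0, add = (+), module.smult = (\<lambda>c \<gamma>. cpoly c * \<gamma>),
     gact = (\<lambda>y \<gamma>. \<Sum>x\<in>UNIV. cpoly (Poly_Mapping.lookup y x) * Gamma_act lam a b x \<gamma>)\<rparr>"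

definition is_eta :: "complex \<Rightarrow> complex \<Rightarrow> nat \<Rightarrow> (hpoly \<Rightarrow> complex) \<Rightarrow> bool" where
  "is_eta \<mu> \<beta> s \<phi> \<longleftrightarrow>
     (\<forall>p q. \<phi> (p + q) = \<phi> p + \<phi> q) \<and> (\<forall>c p. \<phi> (cpoly c * p) = c * \<phi> p) \<and>
     (\<forall>i j. \<phi> ((hvar - cpoly \<mu>) ^ i * (hbar - cpoly \<beta>) ^ j) =
        (if i = 0 \<and> j = s - 1 then fact (s - 1) else 0))"

lemma eta_functional_unique:
  assumes "is_eta \<mu> \<beta> s \<phi>" "is_eta \<mu> \<beta> s \<psi>"
  shows "\<phi> = \<psi>"
proof
  fix \<gamma>
  let ?m = "\<lambda>i j. (hvar - cpoly \<mu>) ^ i * (hbar - cpoly \<beta>) ^ j"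
  define W where "W = {p. \<forall>i j. \<phi> (p * ?m i j) = \<psi> (p * ?m i j)}"
  note d = assms[unfolded is_eta_def]
  have add: "p + q \<in> W" if "p \<in> W" "q \<in> W" for p q
    using that d by (simp add: W_def distrib_right)
  have c: "cpoly c * p \<in> W" if "p \<in> W" for c p
    using that d by (simp add: W_def mult.assoc)
  have h0: "(hvar - cpoly \<mu>) * p \<in> W" if "p \<in> W" for p
  proof -
    have "(hvar - cpoly \<mu>) * p * ?m i j = p * ?m (Suc i) j" for i j by (simp add: algebra_simps)
    with that show ?thesis unfolding W_def mem_Collect_eq by presburger
  qed
  have b0: "(hbar - cpoly \<beta>) * p \<in> W" if "p \<in> W" for p
  proof -
    have "(hbar - cpoly \<beta>) * p * ?m i j = p * ?m i (Suc j)" for i j by (simp add: algebra_simps)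
    with that show ?thesis unfolding W_def mem_Collect_eq by presburger
  qed
  have h: "hvar * p \<in> W" if "p \<in> W" for p
    using add[OF h0[OF that] c[OF that, of \<mu>]] by (simp add: algebra_simps)
  have b: "hbar * p \<in> W" if "p \<in> W" for p
    using add[OF b0[OF that] c[OF that, of \<beta>]] by (simp add: algebra_simps)
  have "1 \<in> W" using d by (simp add: W_def)
  have const: "cpoly k \<in> W" for k using c[OF \<open>1 \<in> W\<close>, of k] by simp
  have inner: "[:a:] \<in> W" for a
  proof (induction a)
    case 0
    show ?case using const[of 0] by (simp add: cpoly_def)
  next
    case (pCons k a)
    have "[:pCons k a:] = cpoly k + hvar * [:a:]" by (simp add: cpoly_def hvar_def)
    with add[OF const h[OF pCons(2)]] show ?case by simp
  qed
  have "\<gamma> \<in> W"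
  proof (induction \<gamma>)
    case 0
    show ?case using inner[of 0] by simp
  next
    case (pCons a p)
    have "pCons a p = [:a:] + hbar * p" by (simp add: hbar_def)
    with add[OF inner b[OF pCons(2)]] show ?case by simp
  qed
  then have "\<phi> (\<gamma> * ?m 0 0) = \<psi> (\<gamma> * ?m 0 0)" unfolding W_def by blast
  then show "\<phi> \<gamma> = \<psi> \<gamma>" by simp
qed

lemma eta_functional_exists: "\<exists>\<phi>. is_eta \<mu> \<beta> s \<phi>"
proof -
  define \<epsilon> where "\<epsilon> = (\<lambda>\<gamma>::hpoly. pcompose (map_poly (\<lambda>p. poly p \<mu>) \<gamma>) [:\<beta>, 1:])"
  have coeff: "coeff (map_poly (\<lambda>p. poly p \<mu>) \<gamma>) n = poly (coeff \<gamma> n) \<mu>" for \<gamma> :: hpoly and n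
    by (simp add: coeff_map_poly)
  have ma: "map_poly (\<lambda>p. poly p \<mu>) (p + q) = map_poly (\<lambda>p. poly p \<mu>) p + map_poly (\<lambda>p. poly p \<mu>) q"
    for p q :: hpoly by (rule poly_eqI) (simp add: coeff)
  have mm: "map_poly (\<lambda>p. poly p \<mu>) (p * q) = map_poly (\<lambda>p. poly p \<mu>) p * map_poly (\<lambda>p. poly p \<mu>) q"
    for p q :: hpoly by (rule poly_eqI) (simp add: coeff coeff_mult poly_sum)
  have add: "\<epsilon> (p + q) = \<epsilon> p + \<epsilon> q" and mult: "\<epsilon> (p * q) = \<epsilon> p * \<epsilon> q" for p q
    by (simp_all add: \<epsilon>_def ma mm pcompose_add pcompose_mult)
  have c: "\<epsilon> (cpoly k) = [:k:]" for k by (simp add: \<epsilon>_def cpoly_def map_poly_pCons)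
  have pw: "\<epsilon> (p ^ n) = \<epsilon> p ^ n" for p n
    by (induction n) (use c[of 1] in \<open>simp_all add: mult cpoly_def flip: pCons_one\<close>)
  have minus: "\<epsilon> (p - q) = \<epsilon> p - \<epsilon> q" for p q
    using add[of "p - q" q] by simp
  have hb: "\<epsilon> (hbar - cpoly \<beta>) = monom 1 1" "\<epsilon> (hvar - cpoly \<mu>) = 0"
    unfolding minus c by (simp_all add: \<epsilon>_def hbar_def hvar_def map_poly_pCons pcompose_pCons monom_altdef)
  have "is_eta \<mu> \<beta> s (\<lambda>\<gamma>. fact (s - 1) * coeff (\<epsilon> \<gamma>) (s - 1))"
    unfolding is_eta_def
    by (auto simp: add mult c pw hb monom_power algebra_simps zero_power power_0_left)
  then show ?thesis by blast
qed

lemma eta_well_defined: "\<exists>!\<phi>. is_eta \<mu> \<beta> s \<phi>"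
  using eta_functional_exists eta_functional_unique by blast

definition eta :: "complex \<Rightarrow> complex \<Rightarrow> nat \<Rightarrow> hpoly \<Rightarrow> complex" where
  "eta \<mu> \<beta> s = (THE \<phi>. is_eta \<mu> \<beta> s \<phi>)"

definition Mmod ::
  "complex \<Rightarrow> complex \<Rightarrow> complex \<Rightarrow> complex \<Rightarrow> complex \<Rightarrow> (hpoly \<Rightarrow> complex) gmodule" where
  "Mmod lam a b \<alpha> \<beta> = (dual (Gamma lam a b))\<lparr>carrier :=
     linear_span (dual (Gamma lam a b))
       {eta (\<alpha> + 2 * of_int k) \<beta> s | (k :: int) (s :: nat). s \<ge> 1}\<rparr>"

section \<open>Mathieu's twisting functor\<close>

text \<open>The action of $U(\mathfrak{g})$ on a $\mathfrak{g}$-module, computed on a representative in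
  the free algebra; for a \<^const>\<open>takiff_module\<close> the choice of representative is immaterial.\<close>

definition word_act :: "'v gmodule \<Rightarrow> takiff_basis fword \<Rightarrow> 'v \<Rightarrow> 'v" where
  "word_act M w v = foldr (\<lambda>x. gact M (Poly_Mapping.single x 1)) (letters w) v"

definition free_act :: "'v gmodule \<Rightarrow> takiff_basis free_alg \<Rightarrow> 'v \<Rightarrow> 'v" where
  "free_act M p v =
     (\<Oplus>\<^bsub>M\<^esub>w\<in>Poly_Mapping.keys p. Poly_Mapping.lookup p w \<odot>\<^bsub>M\<^esub> word_act M w v)"

definition env_act :: "'v gmodule \<Rightarrow> env \<Rightarrow> 'v \<Rightarrow> 'v" where
  "env_act M u = free_act M (rep_env u)"

text \<open>The tensor product $A \otimes_R M$ of a right $R$-module (a type, with right action \<open>ract\<close>)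
  and a left $R$-module (with left action \<open>lact\<close>), as an abelian group.\<close>

definition tensor_relators ::
  "('u::ab_group_add \<Rightarrow> 'r \<Rightarrow> 'u) \<Rightarrow> ('r \<Rightarrow> 'm \<Rightarrow> 'm) \<Rightarrow> ('m, 'x) ring_scheme
     \<Rightarrow> ('u \<times> 'm \<Rightarrow>\<^sub>0 int) set" where
  "tensor_relators ract lact M =
     {frag_of (u + u', m) - frag_of (u, m) - frag_of (u', m) | u u' m. m \<in> carrier M} \<union>
     {frag_of (u, m \<oplus>\<^bsub>M\<^esub> m') - frag_of (u, m) - frag_of (u, m') | u m m'.
        m \<in> carrier M \<and> m' \<in> carrier M} \<union>
     {frag_of (ract u r, m) - frag_of (u, lact r m) | u r m. m \<in> carrier M}"

definition tensor_null ::
  "('u::ab_group_add \<Rightarrow> 'r \<Rightarrow> 'u) \<Rightarrow> ('r \<Rightarrow> 'm \<Rightarrow> 'm) \<Rightarrow> ('m, 'x) ring_scheme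
     \<Rightarrow> ('u \<times> 'm \<Rightarrow>\<^sub>0 int) set" where
  "tensor_null ract lact M =
     generate (free_Abelian_group (UNIV \<times> carrier M)) (tensor_relators ract lact M)"

definition tensor_product ::
  "('u::ab_group_add \<Rightarrow> 'r \<Rightarrow> 'u) \<Rightarrow> ('r \<Rightarrow> 'm \<Rightarrow> 'm) \<Rightarrow> ('m, 'x) ring_scheme
     \<Rightarrow> ('u \<times> 'm \<Rightarrow>\<^sub>0 int) set monoid" where
  "tensor_product ract lact M =
     free_Abelian_group (UNIV \<times> carrier M) Mod tensor_null ract lact M"

text \<open>The map $\phi \otimes \mathrm{id}$ on cosets, for an endomorphism $\phi$ of the right
  $R$-module $A$.\<close>

definition tensor_map ::
  "('u::ab_group_add \<Rightarrow> 'r \<Rightarrow> 'u) \<Rightarrow> ('r \<Rightarrow> 'm \<Rightarrow> 'm) \<Rightarrow> ('m, 'x) ring_scheme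
     \<Rightarrow> ('u \<Rightarrow> 'u) \<Rightarrow> ('u \<times> 'm \<Rightarrow>\<^sub>0 int) set \<Rightarrow> ('u \<times> 'm \<Rightarrow>\<^sub>0 int) set" where
  "tensor_map ract lact M \<phi> K =
     (\<Union>p\<in>K. tensor_null ract lact M #>\<^bsub>free_Abelian_group (UNIV \<times> carrier M)\<^esub>
        frag_extend (\<lambda>(u, m). frag_of (\<phi> u, m)) p)"

text \<open>$B_z M = U^{(\overline{e})} \otimes_{U(\mathfrak{g})} M$ with $y \cdot u \cdot y' =
  \Theta_z(y) u y'$. Complex scalars act through $\mathbb{C} \subseteq U(\mathfrak{g})$, on which
  $\Theta_z$ is the identity.\<close>

definition loc_ract :: "loc \<Rightarrow> env \<Rightarrow> loc" where
  "loc_ract u y = u * localize y"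

definition loc_lact :: "complex \<Rightarrow> env \<Rightarrow> loc \<Rightarrow> loc" where
  "loc_lact z y u = Theta z (localize y) * u"

definition twist :: "complex \<Rightarrow> 'v gmodule \<Rightarrow> (loc \<times> 'v \<Rightarrow>\<^sub>0 int) set gmodule" where
  "twist z M =
    (let T = tensor_product loc_ract (env_act M) M;
         act = (\<lambda>y. tensor_map loc_ract (env_act M) M (loc_lact z y))
     in \<lparr>carrier = carrier T, monoid.mult = undefined, one = undefined,
         ring.zero = \<one>\<^bsub>T\<^esub>, add = monoid.mult T,
         module.smult = (\<lambda>c. act (cscalar c)),
         gact = (\<lambda>y. act (takiff_lin env_gen y))\<rparr>)"

end

theory Submission
  imports Defs
begin

text \<open>On the dual of $\Gamma(\lambda,a,b)$, $U(\mathfrak{g})$ acts by precomposition: $u\varphi = \varphi \circ R(u)$, where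
  $R$ is the anti-representation on $\mathbb{C}[h,\overline{h}]$ in which $x \in \mathfrak{g}$ goes to minus
  its action on $\Gamma(\lambda,a,b)$. There $\overline{e}$ is a nonzero multiple of the shift
  $h \mapsto h - 2$, which is invertible, so $R$ extends to the localization $U^{(\overline{e})}$.

  The space $M_{\alpha,\beta}$ is stable under the extended action (\<open>Mmod_loc_gen\<close>), including
  $\overline{e}^{-1}$, which sends $\eta_{\alpha_k,\beta^s}$ to a multiple of
  $\eta_{\alpha_{k+1},\beta^s}$. A module on which
  $\overline{e}$ is already invertible does not change under localization: $u \otimes \varphi =
  1 \otimes u\varphi$ (\<open>move_to_functional\<close>), and the elements of the tensor product, as cosets of formal
  combinations, are the fibres of $u \otimes \varphi \mapsto u\varphi$ (\<open>null_eq_fibre\<close>, \<open>coset_null\<close>). Hence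
  $B_zM_{\alpha,\beta}$ is $M_{\alpha,\beta}$ with $y$ acting through $\Theta_z(y)$ (\<open>twist_simps\<close>).

  On polynomials, $\Theta_z$ is conjugation by the shift $S(\gamma) = \gamma(h+2z,\overline{h})$
  (\<open>shift_right_act_Theta\<close>). So $\varphi \mapsto \varphi \circ S$ turns the untwisted action into the twisted
  one, and it maps $M_{\alpha-2z,\beta}$ onto $M_{\alpha,\beta}$ because $\eta_{\mu,\beta^s} \circ S =
  \eta_{\mu+2z,\beta^s}$.\<close>

section \<open>The shift automorphism of polynomials in two variables\<close>

lemma cpoly_hom:
  "cpoly 0 = 0" "cpoly 1 = 1" "cpoly (c + d) = cpoly c + cpoly d" "cpoly (c * d) = cpoly c * cpoly d"
  "cpoly (- c) = - cpoly c" "cpoly (c - d) = cpoly c - cpoly d"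
  by (simp_all add: cpoly_def one_pCons)

lemma coeff_shift: "coeff (shift c p) n = pcompose (coeff p n) [:c, 1:]"
  by (simp add: shift_def coeff_map_poly)

lemma shift_cpoly [simp]: "shift c (cpoly d) = cpoly d"
  by (simp add: shift_def cpoly_def map_poly_pCons)

lemma shift_hvar [simp]: "shift c hvar = hvar + cpoly c"
  by (simp add: shift_def hvar_def cpoly_def map_poly_pCons pcompose_pCons)

lemma shift_hbar [simp]: "shift c hbar = hbar"
  by (simp add: shift_def hbar_def map_poly_pCons pcompose_1)

lemma shift_add: "shift c (p + q) = shift c p + shift c q"
  by (rule poly_eqI) (simp add: coeff_shift pcompose_add)

lemma shift_mult: "shift c (p * q) = shift c p * shift c q"
  by (rule poly_eqI) (simp add: coeff_shift coeff_mult pcompose_mult pcompose_sum)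

lemma shift_diff: "shift c (p - q) = shift c p - shift c q"
  using shift_add[of c "p - q" q] by simp

lemma shift_minus: "shift c (- q) = - shift c q"
  using shift_add[of c "- q" q] by (simp add: eq_neg_iff_add_eq_0 shift_def)

lemma shift_power: "shift c (p ^ n) = shift c p ^ n"
  using shift_cpoly[of c 1] by (induction n) (simp_all add: shift_mult cpoly_hom)

lemma shift_shift: "shift c (shift d p) = shift (c + d) p"
  by (rule poly_eqI) (simp add: coeff_shift pcompose_assoc [symmetric] pcompose_pCons algebra_simps)

lemma shift_0: "shift 0 p = p"
  by (rule poly_eqI) (simp add: coeff_shift)

lemma pderiv_shift: "pderiv (shift c p) = shift c (pderiv p)"
  by (rule poly_eqI) (simp add: coeff_shift coeff_pderiv pcompose_smult pcompose_mult of_nat_poly)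

lemma pderiv_vars: "pderiv (cpoly c) = 0" "pderiv hvar = 0" "pderiv hbar = 1"
  by (simp_all add: cpoly_def hvar_def hbar_def pderiv_pCons)

lemma numeral_cpoly: "cpoly (numeral n) = numeral n"
  by (simp add: cpoly_def numeral_poly)

lemma shift_const: "shift c 0 = 0" "shift c (numeral n) = numeral n"
  by (metis shift_cpoly cpoly_hom(1)) (metis shift_cpoly numeral_cpoly)

text \<open>That the six operators satisfy the relations of the Takiff algebra is a finite computation: all of
  them are built from multiplication by $h$ and $\overline{h}$, shifts and $\overline{\partial}$, whose
  commutation rules are the lemmas above.\<close>

lemma Gamma_act_bracket:
  assumes "lam \<noteq> 0"
  shows "Gamma_act lam a b x (Gamma_act lam a b y p) - Gamma_act lam a b y (Gamma_act lam a b x p) =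
    (\<Sum>k\<in>UNIV. cpoly (Poly_Mapping.lookup (takiff_bracket_basis x y) k) * Gamma_act lam a b k p)"
proof -
  (* With lam and 1 / (4 * lam) opaque, every coefficient is a polynomial in u and w, and the
     relation 4 u w = 1 is all that is left of the division. *)
  define u where "u = cpoly lam"
  define w where "w = cpoly (1 / (4 * lam))"
  have uw: "u * (w * 4) = 1"
    using assms by (simp add: u_def w_def flip: cpoly_hom numeral_cpoly)
  have sh: "shift d u = u" "shift d w = w" "pderiv u = 0" "pderiv w = 0" for d
    by (simp_all add: u_def w_def pderiv_vars)
  have c: "cpoly (- 2 * lam) = - (2 * u)" "cpoly (- 1 / (2 * lam)) = - (2 * w)" "cpoly (- 1 / (4 * lam)) = - w"
    by (simp_all add: u_def w_def flip: cpoly_hom numeral_cpoly)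
  note act = Gamma_act.simps[of lam a b, unfolded c, folded u_def]
  note simps = sh shift_const shift_add shift_mult shift_diff shift_minus shift_shift shift_0 shift_power pderiv_shift
    pderiv_mult pderiv_add pderiv_diff pderiv_minus pderiv_vars power2_eq_square cpoly_hom numeral_cpoly
    UNIV_takiff_basis UNIV_sl2_basis tensor_1_def tensor_t_def lookup_add lookup_single
  have "x \<in> {Base E, Base H, Base F, Bar E, Bar H, Bar F}" "y \<in> {Base E, Base H, Base F, Bar E, Bar H, Bar F}"
    using UNIV_takiff_basis by blast+
  then show ?thesis
    by (elim insertE emptyE; hypsubst)
      (simp_all add: algebra_simps uw act simps del: Gamma_act.simps)
qed

section \<open>The anti-representation of the localized enveloping algebra on polynomials\<close>

text \<open>A functional $\varphi$ is acted on by precomposition, $\varphi \mapsto \varphi \circ T$, which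
  reverses the order of operators. The product of two endomorphisms is therefore defined to be their
  composition in the opposite order, so that an algebra homomorphism into this type gives a left
  module of functionals. The endomorphisms form a type of their own in order to be a target of the
  universal property of the localized algebra.\<close>

typedef hpoly_endo = "{T :: hpoly \<Rightarrow> hpoly. (\<forall>p q. T (p + q) = T p + T q) \<and> (\<forall>c p. T (cpoly c * p) = cpoly c * T p)}"
  morphisms apply_endo Endo
  by (rule exI[of _ "\<lambda>p. p"]) simp

setup_lifting type_definition_hpoly_endo

lemma hpoly_endo_eqI: "(\<And>p. apply_endo S p = apply_endo T p) \<Longrightarrow> S = T"
  by (rule apply_endo_inject[THEN iffD1], rule ext)

lemma apply_endo_linear:
  "apply_endo T (p + q) = apply_endo T p + apply_endo T q"
  "apply_endo T (cpoly c * p) = cpoly c * apply_endo T p"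
  using apply_endo[of T] by auto

instantiation hpoly_endo :: complex_algebra
begin
lift_definition zero_hpoly_endo :: hpoly_endo is "\<lambda>p. 0" by simp
lift_definition one_hpoly_endo :: hpoly_endo is "\<lambda>p. p" by simp
lift_definition plus_hpoly_endo :: "hpoly_endo \<Rightarrow> hpoly_endo \<Rightarrow> hpoly_endo" is "\<lambda>S T p. S p + T p"
  by (simp add: algebra_simps)
lift_definition minus_hpoly_endo :: "hpoly_endo \<Rightarrow> hpoly_endo \<Rightarrow> hpoly_endo" is "\<lambda>S T p. S p - T p"
  by (simp add: algebra_simps)
lift_definition uminus_hpoly_endo :: "hpoly_endo \<Rightarrow> hpoly_endo" is "\<lambda>S p. - S p"
  by simp
lift_definition times_hpoly_endo :: "hpoly_endo \<Rightarrow> hpoly_endo \<Rightarrow> hpoly_endo" is "\<lambda>S T p. T (S p)"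
  by simp
lift_definition cscalar_hpoly_endo :: "complex \<Rightarrow> hpoly_endo" is "\<lambda>c p. cpoly c * p"
  by (simp add: algebra_simps)
instance
  by standard (transfer; auto simp: fun_eq_iff cpoly_hom algebra_simps)+
end

lemmas apply_endo_simps =
  zero_hpoly_endo.rep_eq one_hpoly_endo.rep_eq plus_hpoly_endo.rep_eq minus_hpoly_endo.rep_eq
  uminus_hpoly_endo.rep_eq times_hpoly_endo.rep_eq cscalar_hpoly_endo.rep_eq

lemma Gamma_act_linear:
  "Gamma_act lam a b x (p + q) = Gamma_act lam a b x p + Gamma_act lam a b x q"
  "Gamma_act lam a b x (cpoly c * p) = cpoly c * Gamma_act lam a b x p"
proof -
  have "x \<in> {Base E, Base H, Base F, Bar E, Bar H, Bar F}"
    using UNIV_takiff_basis by blast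
  then show "Gamma_act lam a b x (p + q) = Gamma_act lam a b x p + Gamma_act lam a b x q"
    "Gamma_act lam a b x (cpoly c * p) = cpoly c * Gamma_act lam a b x p"
    by (auto simp: shift_add shift_mult pderiv_add pderiv_mult pderiv_vars algebra_simps)
qed

text \<open>The sign is that of the dual module. Since $\overline{e}$ goes to $-\lambda$ times the shift by
  $-2$, its inverse goes to $-\lambda^{-1}$ times the shift by $2$.\<close>

lift_definition symbol_endo :: "complex \<Rightarrow> complex \<Rightarrow> complex \<Rightarrow> loc_symbol \<Rightarrow> hpoly_endo"
  is "\<lambda>lam a b g p. case g of Lie x \<Rightarrow> - Gamma_act lam a b x p | Ebar_inv \<Rightarrow> - cpoly (1 / lam) * shift 2 p"
  by (auto simp: Gamma_act_linear shift_add shift_mult distrib_left mult.left_commute split: loc_symbol.split)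

lemma symbol_endo_simps:
  "apply_endo (symbol_endo lam a b (Lie x)) p = - Gamma_act lam a b x p"
  "apply_endo (symbol_endo lam a b Ebar_inv) p = - cpoly (1 / lam) * shift 2 p"
  by (simp_all add: symbol_endo.rep_eq)

lemma apply_endo_sum: "apply_endo (sum f A) p = (\<Sum>x\<in>A. apply_endo (f x) p)"
  by (induction A rule: infinite_finite_induct) (simp_all add: apply_endo_simps)

lemma apply_takiff_lin:
  "apply_endo (takiff_lin g y) p = (\<Sum>x\<in>UNIV. cpoly (Poly_Mapping.lookup y x) * apply_endo (g x) p)"
  by (simp add: takiff_lin_def apply_endo_sum apply_endo_simps apply_endo_linear)

lemma right_rep_exists:
  assumes "lam \<noteq> 0"
  obtains \<rho> where "is_algebra_hom \<rho>" "\<And>g. \<rho> (loc_gen g) = symbol_endo lam a b g"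
proof (rule loc_hom_exists[of "symbol_endo lam a b"])
  let ?s = "symbol_endo lam a b"
  note neg = symbol_endo_simps Gamma_act_linear(2)[of lam a b _ "-1", simplified cpoly_hom, simplified]
  show "?s (Lie x) * ?s (Lie y) - ?s (Lie y) * ?s (Lie x) =
     takiff_lin (\<lambda>k. ?s (Lie k)) (takiff_bracket_basis x y)" for x y
  proof (rule hpoly_endo_eqI)
    fix p
    have "apply_endo (?s (Lie x) * ?s (Lie y) - ?s (Lie y) * ?s (Lie x)) p
      = - (Gamma_act lam a b x (Gamma_act lam a b y p) - Gamma_act lam a b y (Gamma_act lam a b x p))"
      by (simp add: apply_endo_simps neg)
    also have "\<dots> = apply_endo (takiff_lin (\<lambda>k. ?s (Lie k)) (takiff_bracket_basis x y)) p"
      unfolding Gamma_act_bracket[OF assms] by (simp add: apply_takiff_lin neg sum_negf)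
    finally show "apply_endo (?s (Lie x) * ?s (Lie y) - ?s (Lie y) * ?s (Lie x)) p
      = \<dots>" .
  qed
  have *: "cpoly (1 / lam) * (cpoly lam * p) = p" "cpoly lam * (cpoly (1 / lam) * p) = p" for p
    using assms by (simp_all flip: mult.assoc cpoly_hom(4)) (simp_all add: cpoly_hom)
  have 1: "apply_endo (?s Ebar_inv * ?s (Lie (Bar E))) p = apply_endo 1 p"
    "apply_endo (?s (Lie (Bar E)) * ?s Ebar_inv) p = apply_endo 1 p" for p
    by (simp_all add: apply_endo_simps symbol_endo_simps shift_minus shift_mult shift_shift shift_0 *)
  show "?s Ebar_inv * ?s (Lie (Bar E)) = 1"
    "?s (Lie (Bar E)) * ?s Ebar_inv = 1"
    by (rule hpoly_endo_eqI, rule 1(1), rule hpoly_endo_eqI, rule 1(2))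
  fix \<phi> assume "is_algebra_hom \<phi>" "\<And>g. \<phi> (loc_gen g) = symbol_endo lam a b g"
  then show thesis by (rule that)
qed

locale Gamma_parameters =
  fixes lam a b :: complex
  assumes lam: "lam \<noteq> 0"
begin

definition rho :: "loc \<Rightarrow> hpoly_endo" where
  "rho = (SOME \<rho>. is_algebra_hom \<rho> \<and> (\<forall>g. \<rho> (loc_gen g) = symbol_endo lam a b g))"

lemma rho: "is_algebra_hom rho" "rho (loc_gen g) = symbol_endo lam a b g"
proof -
  have "\<exists>\<rho>. is_algebra_hom \<rho> \<and> (\<forall>g. \<rho> (loc_gen g) = symbol_endo lam a b g)"
    using right_rep_exists[OF lam] by metis
  from someI_ex[OF this, folded rho_def]
  have "is_algebra_hom rho" "\<forall>g. rho (loc_gen g) = symbol_endo lam a b g" by (rule conjunct1, rule conjunct2)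
  then show "is_algebra_hom rho" "rho (loc_gen g) = symbol_endo lam a b g"
    by simp_all
qed

definition right_act :: "loc \<Rightarrow> hpoly \<Rightarrow> hpoly" where "right_act u = apply_endo (rho u)"

lemma right_act_simps:
  "right_act (u + v) p = right_act u p + right_act v p" "right_act (u * v) p = right_act v (right_act u p)"
  "right_act (u - v) p = right_act u p - right_act v p"
  "right_act (cscalar c) p = cpoly c * p" "right_act 1 p = p" "right_act 0 p = 0"
  "right_act (loc_lie x) p = - Gamma_act lam a b x p"
  "right_act (loc_gen Ebar_inv) p = - cpoly (1 / lam) * shift 2 p"
  by (simp_all add: right_act_def is_algebra_homD[OF rho(1)] rho(2) apply_endo_simps symbol_endo_simps)

lemma right_act_linear:
  "right_act u (p + q) = right_act u p + right_act u q" "right_act u (cpoly c * p) = cpoly c * right_act u p"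
  by (simp_all add: right_act_def apply_endo_linear)

text \<open>Hence $y \in \mathfrak{g}$ acts on a functional $\varphi$ of the dual module as
  $\varphi \mapsto \varphi \circ R(y)$.\<close>

lemma right_act_takiff_lin:
  "right_act (takiff_lin loc_lie y) p = - gact (Gamma lam a b) y p"
  by (simp add: right_act_def algebra_hom_takiff_lin[OF rho(1)] apply_takiff_lin rho(2) symbol_endo_simps
      Gamma_def sum_negf)

end

lemma is_Theta_Theta: "is_Theta z (Theta z)"
  unfolding Theta_def by (rule theI'[OF Theta_well_defined])

text \<open>Conjugation by a shift substitutes $h - c$ for $h$ in the coefficients of an operator; for
  $c = 2z$ this turns out to be $\Theta_z$.\<close>

lift_definition conj_shift :: "complex \<Rightarrow> hpoly_endo \<Rightarrow> hpoly_endo"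
  is "\<lambda>c T p. shift (- c) (T (shift c p))"
  by (simp add: shift_add shift_mult)

lemma is_algebra_hom_conj_shift: "is_algebra_hom (conj_shift c)"
  unfolding is_algebra_hom_def
  by (auto intro!: hpoly_endo_eqI simp: apply_endo_simps conj_shift.rep_eq
      shift_add shift_mult shift_shift shift_0)

context Gamma_parameters
begin

text \<open>Both $R \circ \Theta_z$ and the conjugate of $R$ by the shift are algebra homomorphisms, so it is
  enough to compare them on generators. On $\overline{e}, \overline{e}^{-1}, \overline{f}, \overline{h}, e$
  no coefficient contains $h$, and $h$ becomes $h - 2z$. In $f$ only the coefficient
  $(h + 2)\overline{h}$ changes, by $-2z\overline{h}$, and the resulting multiple of
  $\overline{h}$ times the shift by $2$ accounts for the term $-z\overline{e}^{-1}\overline{h}$ of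
  $\Theta_z(f)$.\<close>

lemma shift_right_act_Theta: "shift (2 * z) (right_act (Theta z u) p) = right_act u (shift (2 * z) p)"
proof -
  note T = is_Theta_Theta[of z, unfolded is_Theta_def]
  have "(\<lambda>u. rho (Theta z u)) = (\<lambda>u. conj_shift (2 * z) (rho u))"
  proof (rule hom_loc_ext)
    show "is_algebra_hom (\<lambda>u. rho (Theta z u))" "is_algebra_hom (\<lambda>u. conj_shift (2 * z) (rho u))"
      using T is_algebra_hom_comp[OF rho(1), of "Theta z"]
        is_algebra_hom_comp[OF is_algebra_hom_conj_shift rho(1), of "2 * z"] by simp_all
    fix g
    have "x \<in> {Base E, Base H, Base F, Bar E, Bar H, Bar F}" for x
      using UNIV_takiff_basis by blast
    then have g: "g \<in> {Lie (Base E), Lie (Base H), Lie (Base F), Lie (Bar E), Lie (Bar H), Lie (Bar F), Ebar_inv}"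
      by (cases g) auto
    define x where "x = cpoly (- 1 / (2 * lam))"
    have inv: "cpoly (1 / lam) = - (2 * x)"
      by (simp add: x_def flip: cpoly_hom numeral_cpoly)
    have x: "shift c x = x" "pderiv x = 0" for c
      by (simp_all add: x_def pderiv_vars)
    note act = Gamma_act.simps[of lam a b, folded x_def]
    have Theta:
      "Theta z (loc_lie (Base F)) = loc_lie (Base F) - cscalar z * loc_gen Ebar_inv * loc_lie (Bar H)"
      "Theta z (loc_lie (Base H)) = loc_lie (Base H) + cscalar (2 * z)"
      "Theta z (loc_lie (Bar F)) = loc_lie (Bar F)" "Theta z (loc_lie (Bar H)) = loc_lie (Bar H)"
      "Theta z (loc_lie (Bar E)) = loc_lie (Bar E)" "Theta z (loc_lie (Base E)) = loc_lie (Base E)"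
      "Theta z (loc_gen Ebar_inv) = loc_gen Ebar_inv"
      using T by simp_all
    have "right_act (Theta z (loc_gen g)) p = shift (- (2 * z)) (right_act (loc_gen g) (shift (2 * z) p))" for p
      using g
      by (elim insertE emptyE; hypsubst)
        (simp_all add: Theta right_act_simps act inv x shift_shift shift_0 shift_mult shift_add shift_minus shift_diff shift_power
        cpoly_hom pderiv_shift pderiv_mult numeral_cpoly shift_const algebra_simps del: Gamma_act.simps)
    then show "rho (Theta z (loc_gen g)) = conj_shift (2 * z) (rho (loc_gen g))"
      by (auto intro!: hpoly_endo_eqI simp: right_act_def conj_shift.rep_eq)
  qed
  from fun_cong[OF this, of u] show ?thesis
    by (simp add: right_act_def conj_shift.rep_eq shift_shift shift_0)
qed

end

section \<open>Spaces of functionals and linear spans\<close>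

lemma carrier_dual_Gamma:
  "\<phi> \<in> carrier (dual (Gamma lam a b)) \<longleftrightarrow>
     (\<forall>p q. \<phi> (p + q) = \<phi> p + \<phi> q) \<and> (\<forall>c p. \<phi> (cpoly c * p) = c * \<phi> p)"
  by (simp add: dual_def Gamma_def)

lemma dual_Gamma_simps:
  "\<zero>\<^bsub>dual (Gamma lam a b)\<^esub> = (\<lambda>p. 0)"
  "\<phi> \<oplus>\<^bsub>dual (Gamma lam a b)\<^esub> \<psi> = (\<lambda>p. \<phi> p + \<psi> p)"
  "c \<odot>\<^bsub>dual (Gamma lam a b)\<^esub> \<phi> = (\<lambda>p. c * \<phi> p)"
  "gact (dual (Gamma lam a b)) y \<phi> = (\<lambda>p. - \<phi> (gact (Gamma lam a b) y p))"
  by (simp_all add: dual_def Gamma_def restrict_UNIV)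

lemma ring_of_type_algebra_simps:
  "carrier ring_of_type_algebra = UNIV"
  "x \<oplus>\<^bsub>ring_of_type_algebra\<^esub> y = x + y" "x \<otimes>\<^bsub>ring_of_type_algebra\<^esub> y = x * y"
  "\<one>\<^bsub>ring_of_type_algebra\<^esub> = 1" "\<zero>\<^bsub>ring_of_type_algebra\<^esub> = 0"
  by (simp_all add: ring_of_type_algebra_def)

lemma abelian_group_dual_Gamma: "abelian_group (dual (Gamma lam a b))"
proof (rule abelian_groupI)
  fix \<phi> assume \<phi>: "\<phi> \<in> carrier (dual (Gamma lam a b))"
  show "\<exists>\<psi>\<in>carrier (dual (Gamma lam a b)). \<psi> \<oplus>\<^bsub>dual (Gamma lam a b)\<^esub> \<phi> = \<zero>\<^bsub>dual (Gamma lam a b)\<^esub>"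
    by (rule bexI[of _ "\<lambda>p. - \<phi> p"]) (use \<phi> in \<open>auto simp: carrier_dual_Gamma dual_Gamma_simps\<close>)
qed (auto simp: carrier_dual_Gamma dual_Gamma_simps algebra_simps)

lemma module_dual_Gamma: "module ring_of_type_algebra (dual (Gamma lam a b))"
  by (rule moduleI[OF cring_from_type_algebra abelian_group_dual_Gamma])
    (auto simp: carrier_dual_Gamma dual_Gamma_simps ring_of_type_algebra_simps algebra_simps)

lemma a_minus_dual_Gamma:
  assumes "\<phi> \<in> carrier (dual (Gamma lam a b))"
  shows "\<ominus>\<^bsub>dual (Gamma lam a b)\<^esub> \<phi> = (\<lambda>p. - \<phi> p)"
  by (rule abelian_group.minus_equality[OF abelian_group_dual_Gamma _ assms])
    (use assms in \<open>auto simp: carrier_dual_Gamma dual_Gamma_simps\<close>)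

lemma submodule_dual_Gamma_iff:
  "submodule W ring_of_type_algebra (dual (Gamma lam a b)) \<longleftrightarrow>
     W \<subseteq> carrier (dual (Gamma lam a b)) \<and> (\<lambda>p. 0) \<in> W \<and>
     (\<forall>\<phi>\<in>W. \<forall>\<psi>\<in>W. (\<lambda>p. \<phi> p + \<psi> p) \<in> W) \<and> (\<forall>c. \<forall>\<phi>\<in>W. (\<lambda>p. c * \<phi> p) \<in> W)"
  (is "?L \<longleftrightarrow> ?R")
proof
  assume ?L
  interpret submodule W ring_of_type_algebra "dual (Gamma lam a b)" by fact
  show ?R
    using subset one_closed m_closed smult_closed
    by (auto simp: dual_Gamma_simps ring_of_type_algebra_simps)
next
  assume r: ?R
  show ?L
  proof (rule module.submoduleI[OF module_dual_Gamma])
    fix \<phi> assume "\<phi> \<in> W"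
    moreover have "(\<lambda>p. - 1 * \<phi> p) \<in> W" using r \<open>\<phi> \<in> W\<close> by blast
    ultimately show "\<ominus>\<^bsub>dual (Gamma lam a b)\<^esub> \<phi> \<in> W"
      using r by (subst a_minus_dual_Gamma) auto
  qed (use r in \<open>auto simp: dual_Gamma_simps ring_of_type_algebra_simps\<close>)
qed

lemma linear_span_submodule:
  assumes "S \<subseteq> carrier (dual (Gamma lam a b))"
  shows "submodule (linear_span (dual (Gamma lam a b)) S) ring_of_type_algebra (dual (Gamma lam a b))"
proof -
  have "submodule (carrier (dual (Gamma lam a b))) ring_of_type_algebra (dual (Gamma lam a b))"
    by (rule module.carrier_is_submodule[OF module_dual_Gamma])
  then show ?thesis
    using assms unfolding linear_span_def submodule_dual_Gamma_iff by blast
qed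

lemma linear_span_least:
  assumes "submodule W ring_of_type_algebra M" "S \<subseteq> W"
  shows "linear_span M S \<subseteq> W"
  using assms by (auto simp: linear_span_def)

lemma linear_span_superset: "S \<subseteq> linear_span M S"
  by (auto simp: linear_span_def)

text \<open>The functionals of the dual whose composite with $T$ lies in $W$ form a submodule, so it contains
  the span of $S$ as soon as it contains $S$.\<close>

lemma linear_span_compose:
  assumes T: "\<And>p q. T (p + q) = T p + T q" "\<And>c p. T (cpoly c * p) = cpoly c * T p"
    and S: "S \<subseteq> carrier (dual (Gamma lam a b))"
    and W: "submodule W ring_of_type_algebra (dual (Gamma lam a b))"
    and gen: "\<And>\<phi>. \<phi> \<in> S \<Longrightarrow> (\<lambda>p. \<phi> (T p)) \<in> W"
    and \<phi>: "\<phi> \<in> linear_span (dual (Gamma lam a b)) S"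
  shows "(\<lambda>p. \<phi> (T p)) \<in> W"
proof -
  let ?W = "{\<phi> \<in> carrier (dual (Gamma lam a b)). (\<lambda>p. \<phi> (T p)) \<in> W}"
  have "submodule ?W ring_of_type_algebra (dual (Gamma lam a b))"
    using W T unfolding submodule_dual_Gamma_iff by (auto simp: carrier_dual_Gamma algebra_simps)
  from linear_span_least[OF this] S gen have "linear_span (dual (Gamma lam a b)) S \<subseteq> ?W" by blast
  with \<phi> show ?thesis by blast
qed

section \<open>The spaces spanned by the functionals eta\<close>

lemma is_eta_eta: "is_eta \<mu> \<beta> s (eta \<mu> \<beta> s)"
  unfolding eta_def by (rule theI'[OF eta_well_defined])

lemma eta_eqI: "is_eta \<mu> \<beta> s \<phi> \<Longrightarrow> eta \<mu> \<beta> s = \<phi>"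
  by (rule eta_functional_unique[OF is_eta_eta])

lemma eta_linear:
  "eta \<mu> \<beta> s (p + q) = eta \<mu> \<beta> s p + eta \<mu> \<beta> s q" "eta \<mu> \<beta> s (cpoly c * p) = c * eta \<mu> \<beta> s p"
  using is_eta_eta[of \<mu> \<beta> s] by (auto simp: is_eta_def)

lemma eta_diff: "eta \<mu> \<beta> s (p - q) = eta \<mu> \<beta> s p - eta \<mu> \<beta> s q"
  using eta_linear(1)[of \<mu> \<beta> s "p - q" q] by simp

lemma eta_monom:
  "eta \<mu> \<beta> s ((hvar - cpoly \<mu>) ^ i * (hbar - cpoly \<beta>) ^ j) = (if i = 0 \<and> j = s - 1 then fact (s - 1) else 0)"
  using is_eta_eta[of \<mu> \<beta> s] by (auto simp: is_eta_def)

lemma eta_carrier: "eta \<mu> \<beta> s \<in> carrier (dual (Gamma lam a b))"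
  by (simp add: carrier_dual_Gamma eta_linear)

text \<open>The functional $\eta_{\mu,\beta^s}$ sends $\gamma$ to $\overline{\partial}^{s-1}\gamma$ at
  $(\mu,\beta)$. The next lemmas are the resulting rules for composition with the basic operators. They
  follow from uniqueness: the composite takes the prescribed values on the monomials
  $(h-\mu)^i(\overline{h}-\beta)^j$. Rules that change $s$ have to keep away from $s = 0$: the truncated
  difference $s - 1$ makes $\eta$ at $s = 0$ coincide with $\eta$ at $s = 1$.\<close>

lemma eta_shift: "eta \<mu> \<beta> s (shift c p) = eta (\<mu> + c) \<beta> s p"
proof -
  have "is_eta (\<mu> + c) \<beta> s (\<lambda>p. eta \<mu> \<beta> s (shift c p))"
    unfolding is_eta_def using eta_monom[of \<mu> \<beta> s]
    by (simp add: shift_add shift_mult shift_power shift_diff eta_linear cpoly_hom)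
  from eta_eqI[OF this] show ?thesis by simp
qed

text \<open>To see that $\eta$ vanishes on the multiples of $h - \mu$, add $p \mapsto \eta((h-\mu)p)$ to
  $\eta$: the sum has the values that characterize $\eta$, hence is $\eta$.\<close>

lemma eta_hvar: "eta \<mu> \<beta> s (hvar * p) = \<mu> * eta \<mu> \<beta> s p"
proof -
  have "is_eta \<mu> \<beta> s (\<lambda>p. eta \<mu> \<beta> s p + eta \<mu> \<beta> s ((hvar - cpoly \<mu>) * p))"
    unfolding is_eta_def
  proof (intro conjI allI)
    fix i j
    show "eta \<mu> \<beta> s ((hvar - cpoly \<mu>) ^ i * (hbar - cpoly \<beta>) ^ j) + eta \<mu> \<beta> s ((hvar - cpoly \<mu>) * ((hvar - cpoly \<mu>) ^ i * (hbar - cpoly \<beta>) ^ j))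
      = (if i = 0 \<and> j = s - 1 then fact (s - 1) else 0)"
      using eta_monom[of \<mu> \<beta> s "Suc i" j] by (simp add: eta_monom mult.assoc)
  qed (simp_all add: eta_linear distrib_left mult.left_commute add_ac)
  from eta_eqI[OF this] have "eta \<mu> \<beta> s p = eta \<mu> \<beta> s p + eta \<mu> \<beta> s ((hvar - cpoly \<mu>) * p)"
    by (metis (no_types, lifting))
  then show ?thesis by (simp add: left_diff_distrib eta_diff eta_linear)
qed

lemma eta_hbar_1: "eta \<mu> \<beta> 1 (hbar * p) = \<beta> * eta \<mu> \<beta> 1 p"
proof -
  have "is_eta \<mu> \<beta> 1 (\<lambda>p. eta \<mu> \<beta> 1 p + eta \<mu> \<beta> 1 ((hbar - cpoly \<beta>) * p))"
    unfolding is_eta_def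
  proof (intro conjI allI)
    fix i j
    show "eta \<mu> \<beta> 1 ((hvar - cpoly \<mu>) ^ i * (hbar - cpoly \<beta>) ^ j) + eta \<mu> \<beta> 1 ((hbar - cpoly \<beta>) * ((hvar - cpoly \<mu>) ^ i * (hbar - cpoly \<beta>) ^ j))
      = (if i = 0 \<and> j = 1 - 1 then fact (1 - 1) else 0)"
      using eta_monom[of \<mu> \<beta> 1 i "Suc j"] eta_monom[of \<mu> \<beta> 1 i j] by (simp add: mult.left_commute)
  qed (simp_all add: eta_linear distrib_left mult.left_commute add_ac)
  from eta_eqI[OF this] have "eta \<mu> \<beta> 1 p = eta \<mu> \<beta> 1 p + eta \<mu> \<beta> 1 ((hbar - cpoly \<beta>) * p)"
    by (metis (no_types, lifting))
  then show ?thesis by (simp add: left_diff_distrib eta_diff eta_linear)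
qed

text \<open>Multiplication by $\overline{h} - \beta$ lowers $s$ by one; the factor $s$ is the quotient
  $s!/(s-1)!$ of the normalizations.\<close>

lemma eta_hbar_Suc:
  assumes "s \<ge> 1"
  shows "eta \<mu> \<beta> (Suc s) (hbar * p) = \<beta> * eta \<mu> \<beta> (Suc s) p + of_nat s * eta \<mu> \<beta> s p"
proof -
  obtain r where s: "s = Suc r" using assms by (cases s) auto
  have "is_eta \<mu> \<beta> s (\<lambda>p. eta \<mu> \<beta> (Suc s) ((hbar - cpoly \<beta>) * p) / of_nat s)"
    unfolding is_eta_def
  proof (intro conjI allI)
    fix i j
    show "eta \<mu> \<beta> (Suc s) ((hbar - cpoly \<beta>) * ((hvar - cpoly \<mu>) ^ i * (hbar - cpoly \<beta>) ^ j)) / of_nat s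
      = (if i = 0 \<and> j = s - 1 then fact (s - 1) else 0)"
      using eta_monom[of \<mu> \<beta> "Suc s" i "Suc j"]
      by (simp add: mult.left_commute s del: of_nat_Suc)
  qed (simp_all add: eta_linear distrib_left mult.left_commute add_divide_distrib)
  from fun_cong[OF eta_eqI[OF this], of p]
  have "of_nat s * eta \<mu> \<beta> s p = eta \<mu> \<beta> (Suc s) ((hbar - cpoly \<beta>) * p)"
    using assms by simp
  then show ?thesis by (simp add: left_diff_distrib eta_diff eta_linear)
qed

lemma pderiv_power_hbar: "pderiv ((hbar - cpoly \<beta>) ^ j) = of_nat j * (hbar - cpoly \<beta>) ^ (j - 1)"
  by (cases j) (simp_all add: pderiv_power_Suc pderiv_diff pderiv_vars of_nat_poly del: of_nat_Suc power_Suc)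

lemma eta_pderiv:
  assumes "s \<ge> 1"
  shows "eta \<mu> \<beta> s (pderiv p) = eta \<mu> \<beta> (Suc s) p"
proof -
  have nat: "eta \<mu> \<beta> s (of_nat n * q) = of_nat n * eta \<mu> \<beta> s q" for n q
    using eta_linear(2)[of \<mu> \<beta> s "of_nat n" q] by (simp add: cpoly_def of_nat_poly)
  have pw: "pderiv ((hvar - cpoly \<mu>) ^ i) = 0" for i
    by (induction i) (simp_all add: pderiv_mult pderiv_diff pderiv_vars)
  have "is_eta \<mu> \<beta> (Suc s) (\<lambda>p. eta \<mu> \<beta> s (pderiv p))"
    unfolding is_eta_def
  proof (intro conjI allI)
    fix i j
    have "eta \<mu> \<beta> s (pderiv ((hvar - cpoly \<mu>) ^ i * (hbar - cpoly \<beta>) ^ j))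
      = of_nat j * eta \<mu> \<beta> s ((hvar - cpoly \<mu>) ^ i * (hbar - cpoly \<beta>) ^ (j - 1))"
      by (simp add: pderiv_mult pw pderiv_power_hbar mult.left_commute nat)
    also have "\<dots> = (if i = 0 \<and> j = Suc s - 1 then fact (Suc s - 1) else 0)"
      using assms unfolding eta_monom by (cases j; cases s) auto
    finally show "eta \<mu> \<beta> s (pderiv ((hvar - cpoly \<mu>) ^ i * (hbar - cpoly \<beta>) ^ j)) = \<dots>" .
  qed (simp_all add: eta_linear pderiv_add pderiv_mult pderiv_vars)
  from eta_eqI[OF this] show ?thesis by simp
qed

definition etas :: "complex \<Rightarrow> complex \<Rightarrow> (hpoly \<Rightarrow> complex) set" where
  "etas \<alpha> \<beta> = {eta (\<alpha> + 2 * of_int k) \<beta> s | (k :: int) (s :: nat). s \<ge> 1}"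

lemma carrier_Mmod: "carrier (Mmod lam a b \<alpha> \<beta>) = linear_span (dual (Gamma lam a b)) (etas \<alpha> \<beta>)"
  by (simp add: Mmod_def etas_def)

lemma Mmod_eq: "Mmod lam a b \<alpha> \<beta> = dual (Gamma lam a b)\<lparr>carrier := carrier (Mmod lam a b \<alpha> \<beta>)\<rparr>"
  by (simp add: Mmod_def)

lemma etas_subset: "etas \<alpha> \<beta> \<subseteq> carrier (dual (Gamma lam a b))"
  by (auto simp: etas_def eta_carrier)

lemma submodule_Mmod: "submodule (carrier (Mmod lam a b \<alpha> \<beta>)) ring_of_type_algebra (dual (Gamma lam a b))"
  unfolding carrier_Mmod by (rule linear_span_submodule[OF etas_subset])

lemma Mmod_lincomb:
  "(\<lambda>p. 0) \<in> carrier (Mmod lam a b \<alpha> \<beta>)"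
  "\<phi> \<in> carrier (Mmod lam a b \<alpha> \<beta>) \<Longrightarrow> \<psi> \<in> carrier (Mmod lam a b \<alpha> \<beta>) \<Longrightarrow> (\<lambda>p. \<phi> p + \<psi> p) \<in> carrier (Mmod lam a b \<alpha> \<beta>)"
  "\<phi> \<in> carrier (Mmod lam a b \<alpha> \<beta>) \<Longrightarrow> (\<lambda>p. c * \<phi> p) \<in> carrier (Mmod lam a b \<alpha> \<beta>)"
  "\<phi> \<in> carrier (Mmod lam a b \<alpha> \<beta>) \<Longrightarrow> \<phi> (p + q) = \<phi> p + \<phi> q"
  "\<phi> \<in> carrier (Mmod lam a b \<alpha> \<beta>) \<Longrightarrow> \<phi> (cpoly c * p) = c * \<phi> p"
  "\<phi> \<in> carrier (Mmod lam a b \<alpha> \<beta>) \<Longrightarrow> \<phi> (- p) = - \<phi> p"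
proof -
  note S = submodule_Mmod[of lam a b \<alpha> \<beta>, unfolded submodule_dual_Gamma_iff]
  from S show "(\<lambda>p. 0) \<in> carrier (Mmod lam a b \<alpha> \<beta>)" by blast
  from S show "\<phi> \<in> carrier (Mmod lam a b \<alpha> \<beta>) \<Longrightarrow> \<psi> \<in> carrier (Mmod lam a b \<alpha> \<beta>) \<Longrightarrow> (\<lambda>p. \<phi> p + \<psi> p) \<in> carrier (Mmod lam a b \<alpha> \<beta>)"
   "\<phi> \<in> carrier (Mmod lam a b \<alpha> \<beta>) \<Longrightarrow> (\<lambda>p. c * \<phi> p) \<in> carrier (Mmod lam a b \<alpha> \<beta>)" by blast+
  show "\<phi> \<in> carrier (Mmod lam a b \<alpha> \<beta>) \<Longrightarrow> \<phi> (p + q) = \<phi> p + \<phi> q"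
   "\<phi> \<in> carrier (Mmod lam a b \<alpha> \<beta>) \<Longrightarrow> \<phi> (cpoly c * p) = c * \<phi> p" for p q c
    using S carrier_dual_Gamma by blast+
  from this(2)[of "-1" p] show "\<phi> \<in> carrier (Mmod lam a b \<alpha> \<beta>) \<Longrightarrow> \<phi> (- p) = - \<phi> p"
    by (simp add: cpoly_hom)
qed

lemma Mmod_compose:
  assumes "\<And>p q. T (p + q) = T p + T q" "\<And>c p. T (cpoly c * p) = cpoly c * T p"
    and "\<And>k s. s \<ge> 1 \<Longrightarrow> (\<lambda>p. eta (\<alpha> + 2 * of_int k) \<beta> s (T p)) \<in> carrier (Mmod lam a b \<alpha>' \<beta>)"
    and "\<phi> \<in> carrier (Mmod lam a b \<alpha> \<beta>)"
  shows "(\<lambda>p. \<phi> (T p)) \<in> carrier (Mmod lam a b \<alpha>' \<beta>)"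
  by (rule linear_span_compose[OF assms(1,2) etas_subset submodule_Mmod])
    (use assms(3,4) in \<open>auto simp: carrier_Mmod etas_def\<close>)

lemma eta_in_Mmod: "s \<ge> 1 \<Longrightarrow> eta (\<alpha> + 2 * of_int k) \<beta> s \<in> carrier (Mmod lam a b \<alpha> \<beta>)"
  unfolding carrier_Mmod using linear_span_superset by (fastforce simp: etas_def)

text \<open>A shift by an arbitrary $c$ moves the base point $\alpha$ of the whole family; this is what
  identifies $M_{\alpha-2z,\beta}$ with $M_{\alpha,\beta}$ as spaces. A shift by an even integer only
  permutes the points $\alpha_k$.\<close>

lemma Mmod_shift:
  assumes "\<phi> \<in> carrier (Mmod lam a b \<alpha> \<beta>)"
  shows "(\<lambda>p. \<phi> (shift c p)) \<in> carrier (Mmod lam a b (\<alpha> + c) \<beta>)"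
proof (rule Mmod_compose[OF _ _ _ assms])
  fix k :: int and s :: nat assume "s \<ge> 1"
  then show "(\<lambda>p. eta (\<alpha> + 2 * of_int k) \<beta> s (shift c p)) \<in> carrier (Mmod lam a b (\<alpha> + c) \<beta>)"
    using eta_in_Mmod[of s "\<alpha> + c" k] by (simp add: eta_shift add_ac)
qed (simp_all add: shift_add shift_mult)

lemma Mmod_shift_2:
  assumes "\<phi> \<in> carrier (Mmod lam a b \<alpha> \<beta>)"
  shows "(\<lambda>p. \<phi> (shift (2 * of_int k) p)) \<in> carrier (Mmod lam a b \<alpha> \<beta>)"
proof (rule Mmod_compose[OF _ _ _ assms])
  fix l :: int and s :: nat assume "s \<ge> 1"
  then show "(\<lambda>p. eta (\<alpha> + 2 * of_int l) \<beta> s (shift (2 * of_int k) p)) \<in> carrier (Mmod lam a b \<alpha> \<beta>)"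
    using eta_in_Mmod[of s \<alpha> "l + k"] by (simp add: eta_shift algebra_simps)
qed (simp_all add: shift_add shift_mult)

lemma Mmod_hvar:
  assumes "\<phi> \<in> carrier (Mmod lam a b \<alpha> \<beta>)"
  shows "(\<lambda>p. \<phi> (hvar * p)) \<in> carrier (Mmod lam a b \<alpha> \<beta>)"
  by (rule Mmod_compose[OF _ _ _ assms])
    (simp_all add: eta_hvar Mmod_lincomb eta_in_Mmod distrib_left mult.left_commute)

lemma Mmod_hbar:
  assumes "\<phi> \<in> carrier (Mmod lam a b \<alpha> \<beta>)"
  shows "(\<lambda>p. \<phi> (hbar * p)) \<in> carrier (Mmod lam a b \<alpha> \<beta>)"
proof (rule Mmod_compose[OF _ _ _ assms])
  fix l :: int and s :: nat assume "s \<ge> 1"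
  then consider "s = 1" | r where "r \<ge> 1" "s = Suc r" by (cases s; cases "s = 1") auto
  then show "(\<lambda>p. eta (\<alpha> + 2 * of_int l) \<beta> s (hbar * p)) \<in> carrier (Mmod lam a b \<alpha> \<beta>)"
    by cases (simp_all only: eta_hbar_1 eta_hbar_Suc, auto intro!: Mmod_lincomb eta_in_Mmod)
qed (simp_all add: distrib_left mult.left_commute)

lemma Mmod_pderiv:
  assumes "\<phi> \<in> carrier (Mmod lam a b \<alpha> \<beta>)"
  shows "(\<lambda>p. \<phi> (pderiv p)) \<in> carrier (Mmod lam a b \<alpha> \<beta>)"
  by (rule Mmod_compose[OF _ _ _ assms])
    (simp_all add: eta_pderiv eta_in_Mmod pderiv_add pderiv_mult pderiv_vars)

context Gamma_parameters
begin

text \<open>Every generator acts on polynomials through sums and composites of multiplication by $h$,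
  $\overline{h}$ and constants, $\overline{\partial}$ and the shifts by $\pm 2$, and each of these
  preserves $M_{\alpha,\beta}$. The same holds for $\overline{e}^{-1}$, so that
  $M_{\alpha,\beta}$ is a module over the localized algebra.\<close>

lemma Mmod_loc_gen:
  assumes \<phi>: "\<phi> \<in> carrier (Mmod lam a b \<alpha> \<beta>)"
  shows "(\<lambda>p. \<phi> (right_act (loc_gen g) p)) \<in> carrier (Mmod lam a b \<alpha> \<beta>)"
proof -
  let ?M = "carrier (Mmod lam a b \<alpha> \<beta>)"
  define stable where "stable T \<longleftrightarrow> (\<forall>\<phi>\<in>?M. (\<lambda>p. \<phi> (T p)) \<in> ?M)" for T :: "hpoly \<Rightarrow> hpoly"
  have uminus: "(\<lambda>p. - \<phi> p) \<in> ?M" if "\<phi> \<in> ?M" for \<phi>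
    using Mmod_lincomb(3)[OF that, of "-1"] by simp
  have stable_intros: "stable (\<lambda>p. p)"
    "stable S \<Longrightarrow> stable T \<Longrightarrow> stable (\<lambda>p. S p + T p)" "stable T \<Longrightarrow> stable (\<lambda>p. - T p)"
    "stable T \<Longrightarrow> stable (\<lambda>p. cpoly c * T p)" for S T c
    by (simp_all add: stable_def Mmod_lincomb uminus)
  have stable_ops: "stable T \<Longrightarrow> stable (\<lambda>p. hvar * T p)" "stable T \<Longrightarrow> stable (\<lambda>p. hbar * T p)"
    "stable T \<Longrightarrow> stable (\<lambda>p. pderiv (T p))" "stable T \<Longrightarrow> stable (\<lambda>p. shift 2 (T p))"
    "stable T \<Longrightarrow> stable (\<lambda>p. shift (- 2) (T p))" for T
    using Mmod_hvar Mmod_hbar Mmod_pderiv Mmod_shift_2[where k=1] Mmod_shift_2[where k="-1"]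
    by (auto simp: stable_def)
  have "x \<in> {Base E, Base H, Base F, Bar E, Bar H, Bar F}" for x
    using UNIV_takiff_basis by blast
  then have "g \<in> {Lie (Base E), Lie (Base H), Lie (Base F), Lie (Bar E), Lie (Bar H), Lie (Bar F), Ebar_inv}"
    by (cases g) auto
  then have "stable (right_act (loc_gen g))"
    by (elim insertE emptyE; hypsubst)
      (simp_all only: right_act_simps[abs_def] Gamma_act.simps power2_eq_square distrib_left distrib_right mult.assoc
        mult_minus_left, (intro stable_intros stable_ops)+)
  with \<phi> show ?thesis by (simp add: stable_def)
qed

end

section \<open>The enveloping algebra and its localization\<close>

text \<open>Elements are built by right multiplication with generators because the tensor product over
  $U(\mathfrak{g})$ moves right factors of $u$ across the tensor sign.\<close>

lemma loc_right_induct [case_names scalar mult add]: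
  assumes "\<And>c. P (cscalar c)" "\<And>u g. P u \<Longrightarrow> P (u * loc_gen g)"
    "\<And>u v. P u \<Longrightarrow> P v \<Longrightarrow> P (u + v)"
  shows "P (u :: loc)"
proof -
  note hom = is_algebra_homD[OF is_algebra_hom_abs_loc]
  have word: "P (abs_loc (Poly_Mapping.single w c))" for w c
  proof -
    have "P (cscalar c * prod_list (map loc_gen xs))" for xs
      by (induction xs rule: rev_induct) (simp_all add: assms(1,2) flip: mult.assoc)
    from this[of "letters w"] show ?thesis
      by (simp add: single_eq_free_eval hom is_algebra_hom_prod_list[OF is_algebra_hom_abs_loc] o_def
          flip: loc_gen.abs_eq)
  qed
  have "P (abs_loc p)" for p
  proof (induction p rule: poly_mapping_single_induct)
    case zero
    show ?case using assms(1)[of 0] by (simp add: hom)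
  qed (simp add: hom assms(3) word)
  from this[of "rep_loc u"] show ?thesis by (simp add: abs_loc_rep)
qed

lemma abs_env_rep: "abs_env (rep_env u) = u"
  by (rule Quotient_abs_rep[OF Quotient_env])

lemma localize_rep: "localize u = free_eval loc_lie (rep_env u)"
  using localize.abs_eq[of "rep_env u"] by (simp only: abs_env_rep)

lemma is_algebra_hom_localize: "is_algebra_hom localize"
  unfolding is_algebra_hom_def
proof (intro conjI allI)
  fix u v :: env and c
  note env = is_algebra_homD[OF is_algebra_hom_abs_env, symmetric]
    and ev = is_algebra_homD[OF is_algebra_hom_free_eval]
  have "localize (abs_env p + abs_env q) = localize (abs_env p) + localize (abs_env q)"
    "localize (abs_env p * abs_env q) = localize (abs_env p) * localize (abs_env q)" for p q
    by (simp_all only: env ev localize.abs_eq)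
  from this[of "rep_env u" "rep_env v"]
  show "localize (u + v) = localize u + localize v" "localize (u * v) = localize u * localize v"
    unfolding abs_env_rep .
  show "localize (cscalar c) = cscalar c"
    by (simp only: env ev localize.abs_eq)
qed

lemma localize_gen: "localize (env_gen x) = loc_lie x"
  by (simp add: env_gen.abs_eq localize.abs_eq)

lemma localize_takiff_lin: "localize (takiff_lin env_gen y) = takiff_lin loc_lie y"
  by (simp add: algebra_hom_takiff_lin[OF is_algebra_hom_localize] localize_gen)

lemma takiff_lin_single [simp]: "takiff_lin g (Poly_Mapping.single x 1) = (g x :: 'a::complex_algebra)"
proof -
  have "takiff_lin g (Poly_Mapping.single x 1) = (\<Sum>k\<in>UNIV. if k = x then g x else 0)"
    unfolding takiff_lin_def by (rule sum.cong) (auto simp: lookup_single when_def)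
  then show ?thesis by simp
qed

lemma takiff_lin_add: "takiff_lin g (x + y) = takiff_lin g x + takiff_lin g y"
  by (simp add: takiff_lin_def lookup_add cscalar_add distrib_right sum.distrib)

lemma takiff_lin_scale: "takiff_lin g (takiff_scale c x) = cscalar c * takiff_lin g x"
  by (simp add: takiff_lin_def takiff_scale_def sum_distrib_left Poly_Mapping.map.rep_eq cscalar_mult mult.assoc when_def)
    (auto intro: sum.cong simp: cscalar_mult mult.assoc)

lemma takiff_lin_sum: "takiff_lin g (sum f A) = (\<Sum>x\<in>A. takiff_lin g (f x))"
  by (induction A rule: infinite_finite_induct) (simp_all add: takiff_lin_add takiff_lin_bracket)

text \<open>Generators that satisfy the bracket relations give a Lie algebra map on all of $\mathfrak{g}$, by
  bilinearity.\<close>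

lemma takiff_lin_takiff_bracket:
  fixes g :: "takiff_basis \<Rightarrow> 'a::complex_algebra"
  assumes "\<And>x y. g x * g y - g y * g x = takiff_lin g (takiff_bracket_basis x y)"
  shows "takiff_lin g (takiff_bracket p q) = takiff_lin g p * takiff_lin g q - takiff_lin g q * takiff_lin g p"
proof -
  let ?c = "\<lambda>k. cscalar (Poly_Mapping.lookup p k) :: 'a" and ?d = "\<lambda>k. cscalar (Poly_Mapping.lookup q k) :: 'a"
  have move: "cscalar c * u * (cscalar d * v) = cscalar c * cscalar d * (u * v)" for c d and u v :: 'a
  proof -
    have "cscalar c * u * (cscalar d * v) = cscalar c * (u * cscalar d) * v" by (simp add: mult.assoc)
    also have "u * cscalar d = cscalar d * u" by (rule cscalar_central[symmetric])
    finally show ?thesis by (simp add: mult.assoc)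
  qed
  have cd: "?c x * g x * (?d y * g y) = ?c x * ?d y * (g x * g y)"
    "?d y * g y * (?c x * g x) = ?c x * ?d y * (g y * g x)" for x y
    by (rule move) (simp only: move cscalar_central[of "Poly_Mapping.lookup q y" "?c x"])
  have "takiff_lin g (takiff_bracket p q) = (\<Sum>x\<in>UNIV. \<Sum>y\<in>UNIV. ?c x * ?d y * (g x * g y - g y * g x))"
    by (simp add: takiff_bracket_def takiff_lin_sum takiff_lin_scale assms cscalar_mult)
  also have "\<dots> = (\<Sum>x\<in>UNIV. \<Sum>y\<in>UNIV. ?c x * g x * (?d y * g y)) - (\<Sum>x\<in>UNIV. \<Sum>y\<in>UNIV. ?d y * g y * (?c x * g x))"
    by (simp add: cd right_diff_distrib sum_subtractf)
  also have "(\<Sum>x\<in>UNIV. \<Sum>y\<in>UNIV. ?d y * g y * (?c x * g x)) = takiff_lin g q * takiff_lin g p"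
    unfolding takiff_lin_def sum_product by (rule sum.swap)
  finally show ?thesis by (simp add: takiff_lin_def sum_product)
qed

section \<open>Stable spaces of functionals\<close>

text \<open>The generators $g$ include $\overline{e}^{-1}$, so $\overline{e}$ acts invertibly on $W$. This is
  the situation in which localization changes nothing.\<close>

locale stable_functionals = Gamma_parameters +
  fixes W :: "(hpoly \<Rightarrow> complex) set"
  assumes submodule_W: "submodule W ring_of_type_algebra (dual (Gamma lam a b))"
    and stable_gen: "\<phi> \<in> W \<Longrightarrow> (\<lambda>p. \<phi> (right_act (loc_gen g) p)) \<in> W"
begin

abbreviation M :: "(hpoly \<Rightarrow> complex) gmodule" where
  "M \<equiv> dual (Gamma lam a b)\<lparr>carrier := W\<rparr>"

lemma W_closed:
  "(\<lambda>p. 0) \<in> W"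
  "\<phi> \<in> W \<Longrightarrow> \<psi> \<in> W \<Longrightarrow> (\<lambda>p. \<phi> p + \<psi> p) \<in> W"
  "\<phi> \<in> W \<Longrightarrow> (\<lambda>p. c * \<phi> p) \<in> W"
  "\<phi> \<in> W \<Longrightarrow> \<psi> \<in> W \<Longrightarrow> (\<lambda>p. \<phi> p - \<psi> p) \<in> W"
proof -
  note S = submodule_W[unfolded submodule_dual_Gamma_iff]
  from S show "(\<lambda>p. 0) \<in> W" by blast
  show add: "\<phi> \<in> W \<Longrightarrow> \<psi> \<in> W \<Longrightarrow> (\<lambda>p. \<phi> p + \<psi> p) \<in> W" for \<phi> \<psi> using S by blast
  show "\<phi> \<in> W \<Longrightarrow> (\<lambda>p. c * \<phi> p) \<in> W" for c \<phi> using S by blast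
  from this[of \<psi> "-1"] add[of \<phi> "\<lambda>p. -1 * \<psi> p"] show "\<phi> \<in> W \<Longrightarrow> \<psi> \<in> W \<Longrightarrow> (\<lambda>p. \<phi> p - \<psi> p) \<in> W"
    by simp
qed

lemma W_linear:
  assumes "\<phi> \<in> W"
  shows "\<phi> (p + q) = \<phi> p + \<phi> q" "\<phi> (cpoly c * p) = c * \<phi> p" "\<phi> 0 = 0" "\<phi> (- p) = - \<phi> p" "\<phi> (p - q) = \<phi> p - \<phi> q"
proof -
  show add: "\<phi> (p + q) = \<phi> p + \<phi> q" for p q
    using assms submodule_W carrier_dual_Gamma unfolding submodule_dual_Gamma_iff by blast
  show sc: "\<phi> (cpoly c * p) = c * \<phi> p" for c p
    using assms submodule_W carrier_dual_Gamma unfolding submodule_dual_Gamma_iff by blast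
  show "\<phi> 0 = 0" using sc[of 0 0] by simp
  show neg: "\<phi> (- p) = - \<phi> p" for p using sc[of "-1" p] by (simp add: cpoly_hom)
  show "\<phi> (p - q) = \<phi> p - \<phi> q" using add[of p "- q"] neg by simp
qed

lemma W_sum: "\<phi> \<in> W \<Longrightarrow> \<phi> (sum f A) = (\<Sum>x\<in>A. \<phi> (f x))"
  by (induction A rule: infinite_finite_induct) (simp_all add: W_linear)

lemma stable:
  assumes "\<phi> \<in> W"
  shows "(\<lambda>p. \<phi> (right_act u p)) \<in> W"
  using assms
proof (induction u arbitrary: \<phi> rule: loc_right_induct)
  case (mult u g)
  show ?case using mult.IH[OF stable_gen[OF mult.prems, of g]] by (simp add: right_act_simps)
qed (simp_all add: right_act_simps W_linear W_closed)

lemma M_simps: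
  "carrier M = W" "\<zero>\<^bsub>M\<^esub> = (\<lambda>p. 0)" "\<phi> \<oplus>\<^bsub>M\<^esub> \<psi> = (\<lambda>p. \<phi> p + \<psi> p)" "c \<odot>\<^bsub>M\<^esub> \<phi> = (\<lambda>p. c * \<phi> p)"
  by (simp_all add: dual_Gamma_simps)

lemma gact_M: "\<phi> \<in> W \<Longrightarrow> gact M y \<phi> = (\<lambda>p. \<phi> (right_act (takiff_lin loc_lie y) p))"
  by (simp add: dual_Gamma_simps right_act_takiff_lin W_linear)

lemma module_M: "module ring_of_type_algebra M"
  by (rule submodule.submodule_is_module[OF submodule_W module_dual_Gamma])

lemma a_minus_M:
  assumes "\<phi> \<in> W" "\<psi> \<in> W"
  shows "\<phi> \<ominus>\<^bsub>M\<^esub> \<psi> = (\<lambda>p. \<phi> p - \<psi> p)"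
proof -
  have "\<ominus>\<^bsub>M\<^esub> \<psi> = (\<lambda>p. - \<psi> p)"
    by (rule abelian_group.minus_equality[OF module.axioms(2)[OF module_M]])
      (use assms W_closed(3)[of \<psi> "-1"] in \<open>simp_all add: dual_Gamma_simps\<close>)
  then show ?thesis by (simp add: a_minus_def dual_Gamma_simps)
qed

lemma takiff_module_M: "takiff_module M"
proof (intro takiff_module.intro takiff_module_axioms.intro module_M)
  fix x y c v w
  assume "v \<in> carrier M"
  then have v: "v \<in> W" by simp
  show "gact M x v \<in> carrier M" unfolding gact_M[OF v] M_simps by (rule stable[OF v])
  show "gact M (x + y) v = gact M x v \<oplus>\<^bsub>M\<^esub> gact M y v"
    by (simp only: M_simps gact_M[OF v] takiff_lin_add right_act_simps W_linear[OF v])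
  show "gact M (takiff_scale c x) v = c \<odot>\<^bsub>M\<^esub> gact M x v"
    by (simp only: M_simps gact_M[OF v] takiff_lin_scale right_act_simps right_act_linear W_linear[OF v])
  show "gact M x (c \<odot>\<^bsub>M\<^esub> v) = c \<odot>\<^bsub>M\<^esub> gact M x v"
    by (simp only: M_simps gact_M[OF v] gact_M[OF W_closed(3)[OF v]])
  show "gact M (takiff_bracket x y) v = gact M x (gact M y v) \<ominus>\<^bsub>M\<^esub> gact M y (gact M x v)"
    unfolding gact_M[OF v] gact_M[OF stable[OF v]] a_minus_M[OF stable[OF stable[OF v]] stable[OF stable[OF v]]]
      takiff_lin_takiff_bracket[OF loc_lie_commutator] right_act_simps W_linear[OF v] ..
  show "gact M x (v \<oplus>\<^bsub>M\<^esub> w) = gact M x v \<oplus>\<^bsub>M\<^esub> gact M x w" if "w \<in> carrier M"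
  proof -
    from that have w: "w \<in> W" by simp
    show ?thesis by (simp only: M_simps gact_M[OF v] gact_M[OF w] gact_M[OF W_closed(2)[OF v w]])
  qed
qed

lemma finsum_M:
  assumes "f \<in> A \<rightarrow> W" "finite A"
  shows "(\<Oplus>\<^bsub>M\<^esub>x\<in>A. f x) = (\<lambda>p. \<Sum>x\<in>A. f x p)"
proof -
  interpret abelian_monoid M
    by (rule abelian_group.axioms(1)[OF module.axioms(2)[OF module_M]])
  show ?thesis
    using assms(2,1)
  proof (induction A rule: finite_induct)
    case (insert x A)
    then have "(\<Oplus>\<^bsub>M\<^esub>x\<in>insert x A. f x) = f x \<oplus>\<^bsub>M\<^esub> (\<Oplus>\<^bsub>M\<^esub>x\<in>A. f x)"
      by (intro finsum_insert) auto
    with insert show ?case by (simp add: dual_Gamma_simps)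
  qed (simp add: dual_Gamma_simps)
qed

lemma word_act_M:
  assumes "\<phi> \<in> W"
  shows "word_act M w \<phi> = (\<lambda>p. \<phi> (right_act (prod_list (map loc_lie (letters w))) p))"
proof -
  have "foldr (\<lambda>x. gact M (Poly_Mapping.single x 1)) xs \<phi> = (\<lambda>p. \<phi> (right_act (prod_list (map loc_lie xs)) p))" for xs
    by (induction xs) (simp_all only: foldr.simps o_apply id_apply list.map prod_list.Nil prod_list.Cons
        gact_M[OF assms] gact_M[OF stable[OF assms]] takiff_lin_single right_act_simps)
  then show ?thesis by (simp add: word_act_def)
qed

lemma env_act_M:
  assumes "\<phi> \<in> W"
  shows "env_act M u \<phi> = (\<lambda>p. \<phi> (right_act (localize u) p))"
proof -
  have "free_act M q \<phi> = (\<lambda>p. \<phi> (right_act (free_eval loc_lie q) p))" for q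
  proof -
    have "free_act M q \<phi> = (\<lambda>p. \<Sum>w\<in>Poly_Mapping.keys q. Poly_Mapping.lookup q w * \<phi> (right_act (prod_list (map loc_lie (letters w))) p))"
      unfolding free_act_def
      unfolding word_act_M[OF assms] M_simps
      by (rule finsum_M) (auto intro!: W_closed(3) stable[OF assms])
    also have "\<dots> = (\<lambda>p. \<phi> (right_act (free_eval loc_lie q) p))"
    proof
      fix p
      have "right_act (\<Sum>w\<in>A. f w) p = (\<Sum>w\<in>A. right_act (f w) p)" for f :: "takiff_basis fword \<Rightarrow> loc" and A
        by (induction A rule: infinite_finite_induct) (simp_all add: right_act_simps)
      then show "(\<Sum>w\<in>Poly_Mapping.keys q. Poly_Mapping.lookup q w * \<phi> (right_act (prod_list (map loc_lie (letters w))) p)) = \<phi> (right_act (free_eval loc_lie q) p)"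
        by (simp add: free_eval_def right_act_simps right_act_linear W_sum W_linear assms)
    qed
    finally show ?thesis .
  qed
  then show ?thesis by (simp add: env_act_def localize_rep)
qed

end

section \<open>Localization of a stable space of functionals\<close>

context stable_functionals
begin

text \<open>The map $u \otimes \varphi \mapsto \varphi \circ R(u)$, on formal integer combinations of pairs.\<close>

definition ev :: "(loc \<times> (hpoly \<Rightarrow> complex) \<Rightarrow>\<^sub>0 int) \<Rightarrow> hpoly \<Rightarrow> complex" where
  "ev q p = (\<Sum>x\<in>Poly_Mapping.keys q. of_int (Poly_Mapping.lookup q x) * snd x (right_act (fst x) p))"

lemma ev_of [simp]: "ev (frag_of (u, \<phi>)) = (\<lambda>p. \<phi> (right_act u p))"
  by (simp add: ev_def fun_eq_iff)

lemma ev_0 [simp]: "ev 0 = (\<lambda>p. 0)"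
  by (simp add: ev_def fun_eq_iff)

lemma ev_add: "ev (q + r) = (\<lambda>p. ev q p + ev r p)"
proof
  fix p
  let ?A = "Poly_Mapping.keys q \<union> Poly_Mapping.keys r"
  have sup: "ev s p = (\<Sum>x\<in>?A. of_int (Poly_Mapping.lookup s x) * snd x (right_act (fst x) p))"
    if "Poly_Mapping.keys s \<subseteq> ?A" for s
    unfolding ev_def using that by (intro sum.mono_neutral_left) (auto simp: in_keys_iff)
  show "ev (q + r) p = ev q p + ev r p"
    using keys_add[of q r] by (simp add: sup lookup_add distrib_right sum.distrib)
qed

lemma ev_minus: "ev (- q) = (\<lambda>p. - ev q p)"
  by (simp add: ev_def fun_eq_iff sum_negf)

lemma ev_diff: "ev (q - r) = (\<lambda>p. ev q p - ev r p)"
  using ev_add[of q "- r"] by (simp add: ev_minus)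

abbreviation G :: "(loc \<times> (hpoly \<Rightarrow> complex) \<Rightarrow>\<^sub>0 int) monoid" where
  "G \<equiv> free_Abelian_group (UNIV \<times> W)"

abbreviation null :: "(loc \<times> (hpoly \<Rightarrow> complex) \<Rightarrow>\<^sub>0 int) set" where
  "null \<equiv> tensor_null loc_ract (env_act M) M"

text \<open>These sets turn out to be the cosets that make up the tensor product.\<close>

definition fibre :: "(hpoly \<Rightarrow> complex) \<Rightarrow> (loc \<times> (hpoly \<Rightarrow> complex) \<Rightarrow>\<^sub>0 int) set" where
  "fibre \<phi> = {q \<in> carrier G. ev q = \<phi>}"

lemma carrier_G_closed:
  "q \<in> carrier G \<Longrightarrow> r \<in> carrier G \<Longrightarrow> q + r \<in> carrier G"
  "q \<in> carrier G \<Longrightarrow> r \<in> carrier G \<Longrightarrow> q - r \<in> carrier G"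
  "q \<in> carrier G \<Longrightarrow> - q \<in> carrier G"
  using keys_add[of q r] keys_diff[of q r] by auto

lemma ev_in_W:
  assumes "q \<in> carrier G"
  shows "ev q \<in> W"
proof -
  from assms have "Poly_Mapping.keys q \<subseteq> UNIV \<times> W" by simp
  then show ?thesis
    by (induction q rule: frag_induction) (auto simp: ev_diff intro: W_closed stable)
qed

lemma relators_carrier: "tensor_relators loc_ract (env_act M) M \<subseteq> carrier G"
proof -
  have frag: "frag_of (u, \<phi>) \<in> carrier G" if "\<phi> \<in> W" for u \<phi> using that by simp
  show ?thesis
    unfolding tensor_relators_def M_simps
    by (auto simp del: carrier_free_Abelian_group_iff frag_of_in_free_Abelian_group
        intro!: carrier_G_closed(2) frag W_closed(2) stable simp: env_act_M)
qed

lemma subgroup_null: "subgroup null G"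
  using group.generate_is_subgroup[OF group_free_Abelian_group relators_carrier]
  by (simp add: tensor_null_def)

lemma null_closed: "0 \<in> null" "q \<in> null \<Longrightarrow> r \<in> null \<Longrightarrow> q + r \<in> null" "q \<in> null \<Longrightarrow> - q \<in> null"
  "q \<in> null \<Longrightarrow> r \<in> null \<Longrightarrow> q - r \<in> null"
proof -
  interpret subgroup null G by (rule subgroup_null)
  show "0 \<in> null" using one_closed by simp
  show add: "q \<in> null \<Longrightarrow> r \<in> null \<Longrightarrow> q + r \<in> null" for q r using m_closed by simp
  show neg: "q \<in> null \<Longrightarrow> - q \<in> null" for q
  proof -
    assume q: "q \<in> null"
    then have "q \<in> carrier G" using subset by blast
    with m_inv_closed[OF q] show "- q \<in> null" by simp
  qed
  show "q \<in> null \<Longrightarrow> r \<in> null \<Longrightarrow> q - r \<in> null" using add[of q "- r"] neg[of r] by simp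
qed

lemma null_relators:
  "\<phi> \<in> W \<Longrightarrow> frag_of (u + v, \<phi>) - frag_of (u, \<phi>) - frag_of (v, \<phi>) \<in> null"
  "\<phi> \<in> W \<Longrightarrow> \<psi> \<in> W \<Longrightarrow> frag_of (u, \<lambda>p. \<phi> p + \<psi> p) - frag_of (u, \<phi>) - frag_of (u, \<psi>) \<in> null"
  "\<phi> \<in> W \<Longrightarrow> frag_of (u * localize r, \<phi>) - frag_of (u, \<lambda>p. \<phi> (right_act (localize r) p)) \<in> null"
proof -
  have incl: "q \<in> tensor_relators loc_ract (env_act M) M \<Longrightarrow> q \<in> null" for q
    unfolding tensor_null_def by (rule generate.incl)
  show "\<phi> \<in> W \<Longrightarrow> frag_of (u + v, \<phi>) - frag_of (u, \<phi>) - frag_of (v, \<phi>) \<in> null"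
    by (rule incl) (auto simp: tensor_relators_def)
  show "\<phi> \<in> W \<Longrightarrow> \<psi> \<in> W \<Longrightarrow> frag_of (u, \<lambda>p. \<phi> p + \<psi> p) - frag_of (u, \<phi>) - frag_of (u, \<psi>) \<in> null"
    by (rule incl) (unfold tensor_relators_def M_simps, blast)
  show "\<phi> \<in> W \<Longrightarrow> frag_of (u * localize r, \<phi>) - frag_of (u, \<lambda>p. \<phi> (right_act (localize r) p)) \<in> null"
    unfolding env_act_M[symmetric] loc_ract_def[symmetric]
    by (rule incl) (unfold tensor_relators_def M_simps, blast)
qed

lemma null_subset_kernel:
  assumes "q \<in> null"
  shows "ev q = (\<lambda>p. 0)"
proof -
  have sub: "subgroup {q \<in> carrier G. ev q = (\<lambda>p. 0)} G"
  proof (rule group.subgroupI[OF group_free_Abelian_group])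
    have "0 \<in> {q \<in> carrier G. ev q = (\<lambda>p. 0)}" by simp
    then show "{q \<in> carrier G. ev q = (\<lambda>p. 0)} \<noteq> {}" by blast
    fix q assume q: "q \<in> {q \<in> carrier G. ev q = (\<lambda>p. 0)}"
    then show "inv\<^bsub>G\<^esub> q \<in> {q \<in> carrier G. ev q = (\<lambda>p. 0)}"
      using carrier_G_closed(3)[of q] by (simp add: ev_minus)
    fix r assume "r \<in> {q \<in> carrier G. ev q = (\<lambda>p. 0)}"
    with q show "q \<otimes>\<^bsub>G\<^esub> r \<in> {q \<in> carrier G. ev q = (\<lambda>p. 0)}"
      using carrier_G_closed(1)[of q r] by (simp add: ev_add)
  qed blast
  have "tensor_relators loc_ract (env_act M) M \<subseteq> {q \<in> carrier G. ev q = (\<lambda>p. 0)}"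
  proof (intro subsetI CollectI conjI)
    fix q assume q: "q \<in> tensor_relators loc_ract (env_act M) M"
    then show "q \<in> carrier G" using relators_carrier by blast
    from q show "ev q = (\<lambda>p. 0)"
      unfolding tensor_relators_def M_simps
      by (auto simp: ev_diff loc_ract_def right_act_simps W_linear env_act_M)
  qed
  from group.generate_subgroup_incl[OF group_free_Abelian_group this sub] assms
  show ?thesis by (auto simp: tensor_null_def)
qed

text \<open>The relation $u \otimes \varphi = 1 \otimes u\varphi$ holds although $u$ need not come from
  $U(\mathfrak{g})$. A last factor from $\mathfrak{g}$ is moved across the tensor sign. For a last factor
  $\overline{e}^{-1}$, put $\psi = \overline{e}^{-1}\varphi$, which is again in $W$; then
  $u\overline{e}^{-1} \otimes \varphi = u\overline{e}^{-1} \otimes \overline{e}\psi = u \otimes \psi$.\<close>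

lemma move_to_functional:
  assumes "\<phi> \<in> W"
  shows "frag_of (u, \<phi>) - frag_of (1, \<lambda>p. \<phi> (right_act u p)) \<in> null"
  using assms
proof (induction u arbitrary: \<phi> rule: loc_right_induct)
  case (scalar c)
  show ?case
    using null_relators(3)[OF scalar, of 1 "cscalar c"] by (simp add: is_algebra_homD[OF is_algebra_hom_localize])
next
  case (mult u g)
  show ?case
  proof (cases g)
    case (Lie x)
    have "frag_of (u * loc_lie x, \<phi>) - frag_of (u, \<lambda>p. \<phi> (right_act (loc_lie x) p)) \<in> null"
      using null_relators(3)[OF mult.prems, of u "env_gen x"] by (simp add: localize_gen)
    from null_closed(2)[OF this mult.IH[OF stable[OF mult.prems, of "loc_lie x"]]]
    show ?thesis by (simp add: Lie right_act_simps(2))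
  next
    case Ebar_inv
    define \<psi> where "\<psi> = (\<lambda>p. \<phi> (right_act (loc_gen Ebar_inv) p))"
    have \<psi>: "\<psi> \<in> W" unfolding \<psi>_def by (rule stable[OF mult.prems])
    have "right_act (loc_gen Ebar_inv) (right_act (loc_lie (Bar E)) p) = p" for p
      by (simp only: right_act_simps(2)[symmetric] loc_Ebar_inv right_act_simps(5))
    then have "frag_of (u, \<psi>) - frag_of (u * loc_gen Ebar_inv, \<phi>) \<in> null"
      using null_relators(3)[OF \<psi>, of "u * loc_gen Ebar_inv" "env_gen (Bar E)"]
      by (simp add: localize_gen mult.assoc loc_Ebar_inv \<psi>_def)
    from null_closed(4)[OF mult.IH[OF \<psi>] this]
    show ?thesis by (simp add: Ebar_inv right_act_simps(2) \<psi>_def)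
  qed
next
  case (add u v)
  have "frag_of (1, \<lambda>p. \<phi> (right_act u p) + \<phi> (right_act v p)) - frag_of (1, \<lambda>p. \<phi> (right_act u p)) - frag_of (1, \<lambda>p. \<phi> (right_act v p)) \<in> null"
    by (rule null_relators(2)[OF stable[OF add.prems] stable[OF add.prems]])
  from null_closed(4)[OF null_closed(2)[OF null_closed(2)[OF null_relators(1)[OF add.prems, of u v]
        add.IH(1)[OF add.prems]] add.IH(2)[OF add.prems]] this]
  show ?case by (simp add: right_act_simps W_linear[OF add.prems] algebra_simps)
qed

lemma frag_of_0_null: "frag_of (u, \<lambda>p. 0) \<in> null"
  using null_closed(3)[OF null_relators(2)[OF W_closed(1) W_closed(1), of u]] by simp

text \<open>Every tensor equals $1 \otimes \varphi$ with $\varphi$ its image in $W$, which makes the map to $W$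
  injective on the tensor product.\<close>

lemma normal_form:
  assumes "q \<in> carrier G"
  shows "q - frag_of (1, ev q) \<in> null"
proof -
  have "ev q \<in> W \<and> q - frag_of (1, ev q) \<in> null"
  proof -
    from assms have "Poly_Mapping.keys q \<subseteq> UNIV \<times> W" by simp
    then show ?thesis
    proof (induction q rule: frag_induction)
      case zero
      show ?case using null_closed(3)[OF frag_of_0_null[of 1]] by (simp add: W_closed)
    next
      case (one x)
      then show ?case using move_to_functional stable by (cases x) auto
    next
      case (diff q r)
      then have W: "ev q \<in> W" "ev r \<in> W" and null: "q - frag_of (1, ev q) \<in> null" "r - frag_of (1, ev r) \<in> null"
        by blast+
      have d: "ev (q - r) \<in> W" by (simp add: ev_diff W_closed W)
      have "frag_of (1, ev q) - frag_of (1, ev (q - r)) - frag_of (1, ev r) \<in> null"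
        using null_relators(2)[OF d W(2), of 1] by (simp add: ev_diff)
      from null_closed(2)[OF null_closed(4)[OF null] this] d
      show ?case by (simp add: algebra_simps)
    qed
  qed
  then show ?thesis ..
qed

lemma null_eq_fibre: "null = fibre (\<lambda>p. 0)"
proof
  show "null \<subseteq> fibre (\<lambda>p. 0)"
    using null_subset_kernel subgroup.subset[OF subgroup_null] unfolding fibre_def by blast
  show "fibre (\<lambda>p. 0) \<subseteq> null"
  proof
    fix q assume "q \<in> fibre (\<lambda>p. 0)"
    then have "q - frag_of (1, \<lambda>p. 0) \<in> null"
      using normal_form[of q] by (simp add: fibre_def)
    from null_closed(2)[OF this frag_of_0_null[of 1]] show "q \<in> null" by simp
  qed
qed

lemma frag_of_in_fibre: "\<phi> \<in> W \<Longrightarrow> frag_of (1, \<phi>) \<in> fibre \<phi>"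
  by (simp add: fibre_def right_act_simps)

lemma coset_null:
  assumes "q \<in> carrier G"
  shows "null #>\<^bsub>G\<^esub> q = fibre (ev q)"
proof -
  have "r \<in> null #>\<^bsub>G\<^esub> q" if "r \<in> fibre (ev q)" for r
  proof -
    have "r - q \<in> null"
      using that assms carrier_G_closed(2)[of r q] by (simp add: null_eq_fibre fibre_def ev_diff)
    then show ?thesis unfolding r_coset_def by (auto intro!: bexI[of _ "r - q"])
  qed
  moreover have "r \<in> fibre (ev q)" if "r \<in> null #>\<^bsub>G\<^esub> q" for r
  proof -
    from that obtain n where "n \<in> fibre (\<lambda>p. 0)" "r = n + q"
      unfolding r_coset_def null_eq_fibre by auto
    with assms carrier_G_closed(1)[of n q] show ?thesis by (simp add: fibre_def ev_add)
  qed
  ultimately show ?thesis by blast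
qed

lemma rcosets_null: "rcosets\<^bsub>G\<^esub> null = fibre ` W"
proof -
  have "rcosets\<^bsub>G\<^esub> null = (\<lambda>q. fibre (ev q)) ` carrier G"
    unfolding RCOSETS_def using coset_null by auto
  also have "\<dots> = fibre ` (ev ` carrier G)" by (simp add: image_image)
  also have "ev ` carrier G = W"
  proof
    show "ev ` carrier G \<subseteq> W" using ev_in_W by blast
    show "W \<subseteq> ev ` carrier G"
    proof
      fix \<phi> assume "\<phi> \<in> W"
      from frag_of_in_fibre[OF this] show "\<phi> \<in> ev ` carrier G"
        unfolding fibre_def by (metis (mono_tags, lifting) imageI mem_Collect_eq)
    qed
  qed
  finally show ?thesis .
qed

lemma set_mult_fibre:
  assumes "\<phi> \<in> W" "\<psi> \<in> W"
  shows "fibre \<phi> <#>\<^bsub>G\<^esub> fibre \<psi> = fibre (\<lambda>p. \<phi> p + \<psi> p)"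
proof
  show "fibre \<phi> <#>\<^bsub>G\<^esub> fibre \<psi> \<subseteq> fibre (\<lambda>p. \<phi> p + \<psi> p)"
  proof
    fix q assume "q \<in> fibre \<phi> <#>\<^bsub>G\<^esub> fibre \<psi>"
    then obtain r t where "r \<in> fibre \<phi>" "t \<in> fibre \<psi>" "q = r + t" by (auto simp: set_mult_def)
    with carrier_G_closed(1)[of r t] show "q \<in> fibre (\<lambda>p. \<phi> p + \<psi> p)" by (simp add: fibre_def ev_add)
  qed
  show "fibre (\<lambda>p. \<phi> p + \<psi> p) \<subseteq> fibre \<phi> <#>\<^bsub>G\<^esub> fibre \<psi>"
  proof
    fix q assume q: "q \<in> fibre (\<lambda>p. \<phi> p + \<psi> p)"
    have 1: "frag_of (1, \<phi>) \<in> fibre \<phi>" by (rule frag_of_in_fibre[OF assms(1)])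
    have "q - frag_of (1, \<phi>) \<in> fibre \<psi>"
      using q 1 carrier_G_closed(2)[of q "frag_of (1, \<phi>)"] by (simp add: fibre_def ev_diff del: ev_of)
    moreover have "q = frag_of (1, \<phi>) \<otimes>\<^bsub>G\<^esub> (q - frag_of (1, \<phi>))" by simp
    ultimately show "q \<in> fibre \<phi> <#>\<^bsub>G\<^esub> fibre \<psi>"
      using 1 unfolding set_mult_def by blast
  qed
qed

lemma ev_left_mult:
  assumes "q \<in> carrier G"
  shows "frag_extend (\<lambda>(u, \<phi>). frag_of (v * u, \<phi>)) q \<in> carrier G"
    and "ev (frag_extend (\<lambda>(u, \<phi>). frag_of (v * u, \<phi>)) q) = (\<lambda>p. ev q (right_act v p))"
proof -
  from assms have "Poly_Mapping.keys q \<subseteq> UNIV \<times> W" by simp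
  then have "frag_extend (\<lambda>(u, \<phi>). frag_of (v * u, \<phi>)) q \<in> carrier G \<and>
    ev (frag_extend (\<lambda>(u, \<phi>). frag_of (v * u, \<phi>)) q) = (\<lambda>p. ev q (right_act v p))"
  proof (induction q rule: frag_induction)
    case (diff q r)
    let ?L = "frag_extend (\<lambda>(u, \<phi>). frag_of (v * u, \<phi>))"
    from diff carrier_G_closed(2)[of "?L q" "?L r"] show ?case
      by (simp add: frag_extend_diff ev_diff)
  qed (auto simp: right_act_simps)
  then show "frag_extend (\<lambda>(u, \<phi>). frag_of (v * u, \<phi>)) q \<in> carrier G"
    "ev (frag_extend (\<lambda>(u, \<phi>). frag_of (v * u, \<phi>)) q) = (\<lambda>p. ev q (right_act v p))" by blast+
qed

text \<open>Left multiplication by $v$ on the first factor becomes the action of $v$ on functionals.\<close>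

lemma tensor_map_fibre:
  assumes "\<phi> \<in> W"
  shows "tensor_map loc_ract (env_act M) M (\<lambda>u. v * u) (fibre \<phi>) = fibre (\<lambda>p. \<phi> (right_act v p))"
proof -
  have "null #>\<^bsub>G\<^esub> frag_extend (\<lambda>(u, m). frag_of (v * u, m)) q = fibre (\<lambda>p. \<phi> (right_act v p))"
    if "q \<in> fibre \<phi>" for q
  proof -
    from that have q: "q \<in> carrier G" "ev q = \<phi>" by (auto simp: fibre_def)
    show ?thesis
      unfolding coset_null[OF ev_left_mult(1)[OF q(1)]] ev_left_mult(2)[OF q(1)] q(2) ..
  qed
  then show ?thesis
    using frag_of_in_fibre[OF assms] unfolding tensor_map_def M_simps by auto
qed

lemma inj_on_fibre: "inj_on fibre W"
proof (rule inj_onI)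
  fix \<phi> \<psi> assume "\<phi> \<in> W" "fibre \<phi> = fibre \<psi>"
  then have "frag_of (1, \<phi>) \<in> fibre \<phi>" "frag_of (1, \<phi>) \<in> fibre \<psi>"
    using frag_of_in_fibre[of \<phi>] by simp_all
  then have "ev (frag_of (1, \<phi>)) = \<phi>" "ev (frag_of (1, \<phi>)) = \<psi>"
    unfolding fibre_def by blast+
  then show "\<phi> = \<psi>" by (rule trans[OF sym])
qed

text \<open>The twisted module is thus $W$ itself, with $y \in \mathfrak{g}$ acting through $\Theta_z(y)$.\<close>

lemma twist_simps:
  "carrier (twist z M) = fibre ` W"
  "\<zero>\<^bsub>twist z M\<^esub> = fibre (\<lambda>p. 0)"
  "\<phi> \<in> W \<Longrightarrow> \<psi> \<in> W \<Longrightarrow> fibre \<phi> \<oplus>\<^bsub>twist z M\<^esub> fibre \<psi> = fibre (\<lambda>p. \<phi> p + \<psi> p)"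
  "\<phi> \<in> W \<Longrightarrow> c \<odot>\<^bsub>twist z M\<^esub> fibre \<phi> = fibre (\<lambda>p. c * \<phi> p)"
  "\<phi> \<in> W \<Longrightarrow> gact (twist z M) y (fibre \<phi>) = fibre (\<lambda>p. \<phi> (right_act (Theta z (takiff_lin loc_lie y)) p))"
proof -
  have act: "loc_lact z y = (\<lambda>u. Theta z (localize y) * u)" for y
    by (simp add: loc_lact_def fun_eq_iff)
  have Theta: "Theta z (cscalar c) = cscalar c" for c
    using is_Theta_Theta[of z] by (simp add: is_Theta_def is_algebra_homD)
  have T: "tensor_product loc_ract (env_act M) M = G Mod null"
    by (simp add: tensor_product_def)
  show "carrier (twist z M) = fibre ` W"
    by (simp add: twist_def Let_def T FactGroup_def rcosets_null)
  show "\<zero>\<^bsub>twist z M\<^esub> = fibre (\<lambda>p. 0)"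
    by (simp add: twist_def Let_def T null_eq_fibre)
  show "\<phi> \<in> W \<Longrightarrow> \<psi> \<in> W \<Longrightarrow> fibre \<phi> \<oplus>\<^bsub>twist z M\<^esub> fibre \<psi> = fibre (\<lambda>p. \<phi> p + \<psi> p)"
    by (simp add: twist_def Let_def T set_mult_fibre)
  show "\<phi> \<in> W \<Longrightarrow> c \<odot>\<^bsub>twist z M\<^esub> fibre \<phi> = fibre (\<lambda>p. c * \<phi> p)"
    by (simp add: twist_def Let_def act tensor_map_fibre is_algebra_homD[OF is_algebra_hom_localize] Theta
        right_act_simps W_linear)
  show "\<phi> \<in> W \<Longrightarrow> gact (twist z M) y (fibre \<phi>) = fibre (\<lambda>p. \<phi> (right_act (Theta z (takiff_lin loc_lie y)) p))"
    by (simp add: twist_def Let_def act tensor_map_fibre localize_takiff_lin)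
qed

end

section \<open>The isomorphism\<close>

text \<open>A bijection that respects the operations carries all module axioms from $N$ to $T$. In this way
  the axioms for the twisted module come for free from those of $M_{\alpha-2z,\beta}$.\<close>

lemma gmodule_iso_of_structure_bijection:
  fixes N :: "'w gmodule" and T :: "'v gmodule"
  assumes N: "takiff_module N" and bij: "bij_betw \<psi> (carrier N) (carrier T)"
    and zero: "\<psi> \<zero>\<^bsub>N\<^esub> = \<zero>\<^bsub>T\<^esub>"
    and add: "\<And>v w. v \<in> carrier N \<Longrightarrow> w \<in> carrier N \<Longrightarrow> \<psi> (v \<oplus>\<^bsub>N\<^esub> w) = \<psi> v \<oplus>\<^bsub>T\<^esub> \<psi> w"
    and smult: "\<And>c v. v \<in> carrier N \<Longrightarrow> \<psi> (c \<odot>\<^bsub>N\<^esub> v) = c \<odot>\<^bsub>T\<^esub> \<psi> v"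
    and gact: "\<And>y v. v \<in> carrier N \<Longrightarrow> \<psi> (gact N y v) = gact T y (\<psi> v)"
  shows "T \<cong>\<^sub>g N"
proof -
  interpret N: takiff_module N by fact
  have car: "carrier T = \<psi> ` carrier N"
    using bij by (simp add: bij_betw_def)
  note sm = N.smult_closed[unfolded ring_of_type_algebra_simps, OF UNIV_I]
  note tr = add[symmetric] smult[symmetric] gact[symmetric] zero[symmetric]
  have T: "abelian_group T"
  proof (rule abelian_groupI)
    fix x assume "x \<in> carrier T"
    then obtain v where v: "v \<in> carrier N" "x = \<psi> v" by (auto simp: car)
    have "\<psi> (\<ominus>\<^bsub>N\<^esub> v) \<oplus>\<^bsub>T\<^esub> x = \<zero>\<^bsub>T\<^esub>"
      using v by (simp add: tr N.l_neg)
    with v show "\<exists>y\<in>carrier T. y \<oplus>\<^bsub>T\<^esub> x = \<zero>\<^bsub>T\<^esub>"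
      by (auto simp: car)
  qed (auto simp: car tr N.a_ac)
  have minus: "\<psi> v \<ominus>\<^bsub>T\<^esub> \<psi> w = \<psi> (v \<ominus>\<^bsub>N\<^esub> w)" if vw: "v \<in> carrier N" "w \<in> carrier N" for v w
  proof -
    have "\<ominus>\<^bsub>T\<^esub> \<psi> w = \<psi> (\<ominus>\<^bsub>N\<^esub> w)"
      by (rule abelian_group.minus_equality[OF T]) (use vw in \<open>simp_all add: car tr N.l_neg\<close>)
    then show ?thesis using vw by (simp add: a_minus_def tr)
  qed
  have "module ring_of_type_algebra T"
    by (rule moduleI[OF cring_from_type_algebra T])
      (use N.smult_l_distr N.smult_r_distr N.smult_assoc1 N.smult_one in
        \<open>auto simp: car tr sm ring_of_type_algebra_simps\<close>)
  then have T_module: "takiff_module T"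
    by (intro takiff_module.intro takiff_module_axioms.intro)
      (auto simp: car tr sm minus N.gact_closed N.gact_add N.gact_smult N.add_gact N.scale_gact N.bracket_gact)
  have inverse: "inv_into (carrier N) \<psi> (\<psi> v) = v" if "v \<in> carrier N" for v
    using bij that by (simp add: bij_betw_def)
  have "\<exists>\<phi>. bij_betw \<phi> (carrier T) (carrier N) \<and>
       (\<forall>v\<in>carrier T. \<forall>w\<in>carrier T. \<phi> (v \<oplus>\<^bsub>T\<^esub> w) = \<phi> v \<oplus>\<^bsub>N\<^esub> \<phi> w) \<and>
       (\<forall>c. \<forall>v\<in>carrier T. \<phi> (c \<odot>\<^bsub>T\<^esub> v) = c \<odot>\<^bsub>N\<^esub> \<phi> v) \<and>
       (\<forall>x. \<forall>v\<in>carrier T. \<phi> (gact T x v) = gact N x (\<phi> v))"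
  proof (intro exI[of _ "inv_into (carrier N) \<psi>"] conjI)
    show "bij_betw (inv_into (carrier N) \<psi>) (carrier T) (carrier N)"
      by (rule bij_betw_inv_into[OF bij])
  qed (auto simp: car tr inverse sm N.gact_closed)
  with T_module N show ?thesis by (simp add: gmodule_iso_def)
qed

context Gamma_parameters
begin

lemma stable_functionals_Mmod: "stable_functionals lam a b (carrier (Mmod lam a b \<alpha> \<beta>))"
  by (intro stable_functionals.intro stable_functionals_axioms.intro Gamma_parameters_axioms
      submodule_Mmod Mmod_loc_gen)

lemma bij_betw_Mmod_shift:
  "bij_betw (\<lambda>\<phi> p. \<phi> (shift c p)) (carrier (Mmod lam a b (\<alpha> - c) \<beta>)) (carrier (Mmod lam a b \<alpha> \<beta>))"
proof (rule bij_betw_byWitness[where f' = "\<lambda>\<phi> p. \<phi> (shift (- c) p)"])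
  show "(\<lambda>\<phi> p. \<phi> (shift c p)) ` carrier (Mmod lam a b (\<alpha> - c) \<beta>) \<subseteq> carrier (Mmod lam a b \<alpha> \<beta>)"
    using Mmod_shift[of _ lam a b "\<alpha> - c" \<beta> c] by auto
  show "(\<lambda>\<phi> p. \<phi> (shift (- c) p)) ` carrier (Mmod lam a b \<alpha> \<beta>) \<subseteq> carrier (Mmod lam a b (\<alpha> - c) \<beta>)"
    using Mmod_shift[of _ lam a b \<alpha> \<beta> "- c"] by auto
qed (simp_all add: shift_shift shift_0)

text \<open>The isomorphism sends $\varphi \in M_{\alpha-2z,\beta}$ to $1 \otimes (\varphi \circ S)$, where $S$ is
  the shift by $2z$.\<close>

theorem twist_Mmod_iso: "twist z (Mmod lam a b \<alpha> \<beta>) \<cong>\<^sub>g Mmod lam a b (\<alpha> - 2 * z) \<beta>"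
proof -
  interpret A: stable_functionals lam a b "carrier (Mmod lam a b \<alpha> \<beta>)"
    by (rule stable_functionals_Mmod)
  interpret B: stable_functionals lam a b "carrier (Mmod lam a b (\<alpha> - 2 * z) \<beta>)"
    by (rule stable_functionals_Mmod)
  note A = A.twist_simps[folded Mmod_eq]
  let ?S = "\<lambda>\<phi> p. \<phi> (shift (2 * z) p)"
  have S: "?S \<phi> \<in> carrier (Mmod lam a b \<alpha> \<beta>)" if "\<phi> \<in> carrier (Mmod lam a b (\<alpha> - 2 * z) \<beta>)" for \<phi>
    using bij_betwE[OF bij_betw_Mmod_shift] that by blast
  show ?thesis
  proof (rule gmodule_iso_of_structure_bijection[where \<psi> = "\<lambda>\<phi>. A.fibre (?S \<phi>)"])
    show "takiff_module (Mmod lam a b (\<alpha> - 2 * z) \<beta>)"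
      by (rule B.takiff_module_M[folded Mmod_eq])
    show "bij_betw (\<lambda>\<phi>. A.fibre (?S \<phi>)) (carrier (Mmod lam a b (\<alpha> - 2 * z) \<beta>)) (carrier (twist z (Mmod lam a b \<alpha> \<beta>)))"
      using bij_betw_trans[OF bij_betw_Mmod_shift[of "2 * z" \<alpha> \<beta>] inj_on_imp_bij_betw[OF A.inj_on_fibre]]
      by (simp add: A o_def)
  next
    show "A.fibre (?S \<zero>\<^bsub>Mmod lam a b (\<alpha> - 2 * z) \<beta>\<^esub>) = \<zero>\<^bsub>twist z (Mmod lam a b \<alpha> \<beta>)\<^esub>"
      by (simp only: A B.M_simps[folded Mmod_eq])
  next
    fix c y \<phi> \<psi> assume \<phi>: "\<phi> \<in> carrier (Mmod lam a b (\<alpha> - 2 * z) \<beta>)"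
    show "A.fibre (?S (c \<odot>\<^bsub>Mmod lam a b (\<alpha> - 2 * z) \<beta>\<^esub> \<phi>)) = c \<odot>\<^bsub>twist z (Mmod lam a b \<alpha> \<beta>)\<^esub> A.fibre (?S \<phi>)"
      unfolding A(4)[OF S[OF \<phi>]] B.M_simps[folded Mmod_eq] ..
    show "A.fibre (?S (gact (Mmod lam a b (\<alpha> - 2 * z) \<beta>) y \<phi>)) = gact (twist z (Mmod lam a b \<alpha> \<beta>)) y (A.fibre (?S \<phi>))"
      unfolding A(5)[OF S[OF \<phi>]] B.gact_M[folded Mmod_eq, OF \<phi>] shift_right_act_Theta ..
    assume \<psi>: "\<psi> \<in> carrier (Mmod lam a b (\<alpha> - 2 * z) \<beta>)"
    show "A.fibre (?S (\<phi> \<oplus>\<^bsub>Mmod lam a b (\<alpha> - 2 * z) \<beta>\<^esub> \<psi>)) = A.fibre (?S \<phi>) \<oplus>\<^bsub>twist z (Mmod lam a b \<alpha> \<beta>)\<^esub> A.fibre (?S \<psi>)"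
      unfolding A(3)[OF S[OF \<phi>] S[OF \<psi>]] B.M_simps[folded Mmod_eq] ..
  qed
qed

end

theorem theorem1p4:
  fixes lam a b \<alpha> \<beta> z :: complex
  assumes "lam \<noteq> 0"
  shows "twist z (Mmod lam a b \<alpha> \<beta>) \<cong>\<^sub>g Mmod lam a b (\<alpha> - 2 * z) \<beta>"
  by (rule Gamma_parameters.twist_Mmod_iso) (use assms in unfold_locales)

end
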